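(* The category of free augmented directed complexes (the full subcategory of $\mathbf{ADC}$ on the augmented directed complexes that admit a basis) is equivalent to the slice category $\mathbf{APC}/1[0]$, where $\mathbf{APC}$ is the category of additive parity complexes and $1[0]$ is the additive parity complex consisting of a single element in dimension zero and no elements in other dimensions.
   Context: **Augmented directed complexes.** A preordered abelian group is an abelian group $A$ with a preorder such that $a\le b$ implies $a+c\le b+c$; $A^*=\{a\in A: a\ge0\}$. A basis of $A$ is a subset $B\subseteq A^*$ which is a basis of both the commutative monoid $A^*$ and the abelian group $A$ (unique if it exists). A directed chain complex is a chain complex $K$ of abelian groups in degrees $\ge0$ with each $K_n$ a preordered abelian group (boundary maps not assumed monotone); morphisms are chain maps that are monotone in each degree. An augmented directed complex is a directed chain complex $K$ with a monotone homomorphism $\varepsilon\colon K_0\to\mathbb{Z}$ (natural order on $\mathbb{Z}$) with $\varepsilon\partial=0$; morphisms are augmentation-preserving morphisms of directed chain complexes. A basis of $K$ is a family $B=(B_n)_{n\ge0}$ with $B_n$ a basis of $K_n$; $K$ is free if it admits a basis. **Multisets.** $\mathcal{M}_f(B)$ is the set of finite multisets of a set $B$, i.e. functions $B\to\mathbb{N}$ of finite support; it is the free commutative monoid on $B$ under pointwise addition $\sqcup$. Put $(S\setminus T)(b)=\max(S(b)-T(b),0)$. Multisets $S,T$ are disjoint if $\min(S(b),T(b))=0$ for all $b$. **Additive parity complexes.** An additive parity structure is a graded set $B=(B_n)_{n\ge0}$ together with, for each $n\ge0$ and $x\in B_{n+1}$, a disjoint pair of finite multisets $\partial^-x,\partial^+x$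 of $B_n$. Let $\Phi^-,\Phi^+\colon\mathcal{M}_f(B_{n+1})\to\mathcal{M}_f(B_n)$ be the unique monoid homomorphisms extending $\partial^-,\partial^+\colon B_{n+1}\to\mathcal{M}_f(B_n)$, and for $S\in\mathcal{M}_f(B_{n+1})$ set $\partial^-(S)=\Phi^-(S)\setminus\Phi^+(S)$, $\partial^+(S)=\Phi^+(S)\setminus\Phi^-(S)$. An additive parity complex is an additive parity structure such that for all $n\ge0$, $x\in B_{n+2}$: $\partial^-\partial^-x=\partial^-\partial^+x$ and $\partial^+\partial^-x=\partial^+\partial^+x$. For $S\in\mathcal{M}_f(B_{n+1})$, $M,P\in\mathcal{M}_f(B_n)$, $S$ moves $M$ to $P$ if $\partial^-(S)=M\setminus P$ and $\partial^+(S)=P\setminus M$. A morphism $f\colon B\to C$ of additive parity complexes is a family of functions $f_n\colon B_n\to\mathcal{M}_f(C_n)$, $n\ge0$ (also denoting their homomorphic extensions $\mathcal{M}_f(B_n)\to\mathcal{M}_f(C_n)$), such that for each $n\ge0$ and $x\in B_{n+1}$, $f_{n+1}(x)$ moves $f_n(\partial^-x)$ to $f_n(\partial^+x)$. Composites are $(g\circ f)_n=g_n\circ f_n$ using the homomorphic extension of $g_n$; identities send $x$ to the singleton $\{x\}$. *)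

theory Defs
  imports "HOL-Algebra.Free_Abelian_Groups" "HOL-Library.Multiset"
begin

section \<open>Categories, functors and equivalences\<close>

text \<open>
  The object type and the arrow type of a category are HOL types; \<open>Obj\<close> and \<open>Hom\<close> cut out
  the actual objects and arrows. \<open>Hom\<close>-sets of different pairs of objects need not be
  disjoint, so composition takes the three objects involved as arguments:
  \<open>Comp C a b c g f\<close> is the composite of \<open>f : a \<rightarrow> b\<close> followed by \<open>g : b \<rightarrow> c\<close>.
\<close>

record ('o, 'm) cat =
  Obj :: "'o set"
  Hom :: "'o \<Rightarrow> 'o \<Rightarrow> 'm set"
  Id :: "'o \<Rightarrow> 'm"
  Comp :: "'o \<Rightarrow> 'o \<Rightarrow> 'o \<Rightarrow> 'm \<Rightarrow> 'm \<Rightarrow> 'm"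

locale category =
  fixes C :: "('o, 'm) cat"
  assumes Id_in_Hom: "a \<in> Obj C \<Longrightarrow> Id C a \<in> Hom C a a"
    and Comp_in_Hom: "\<lbrakk>a \<in> Obj C; b \<in> Obj C; c \<in> Obj C; f \<in> Hom C a b; g \<in> Hom C b c\<rbrakk>
      \<Longrightarrow> Comp C a b c g f \<in> Hom C a c"
    and Comp_Id_left: "\<lbrakk>a \<in> Obj C; b \<in> Obj C; f \<in> Hom C a b\<rbrakk>
      \<Longrightarrow> Comp C a b b (Id C b) f = f"
    and Comp_Id_right: "\<lbrakk>a \<in> Obj C; b \<in> Obj C; f \<in> Hom C a b\<rbrakk>
      \<Longrightarrow> Comp C a a b f (Id C a) = f"
    and Comp_assoc: "\<lbrakk>a \<in> Obj C; b \<in> Obj C; c \<in> Obj C; d \<in> Obj C;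
        f \<in> Hom C a b; g \<in> Hom C b c; h \<in> Hom C c d\<rbrakk>
      \<Longrightarrow> Comp C a c d h (Comp C a b c g f) = Comp C a b d (Comp C b c d h g) f"

definition full_subcategory :: "('o, 'm) cat \<Rightarrow> ('o \<Rightarrow> bool) \<Rightarrow> ('o, 'm) cat"
  where "full_subcategory C P = C\<lparr>Obj := {a \<in> Obj C. P a}\<rparr>"

definition slice :: "('o, 'm) cat \<Rightarrow> 'o \<Rightarrow> ('o \<times> 'm, 'm) cat"
  where "slice C z =
    \<lparr>Obj = {(a, p). a \<in> Obj C \<and> p \<in> Hom C a z},
     Hom = (\<lambda>(a, p) (b, q). {f \<in> Hom C a b. Comp C a b z q f = p}),
     Id = (\<lambda>(a, p). Id C a),
     Comp = (\<lambda>(a, p) (b, q) (c, r). Comp C a b c)\<rparr>"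

record ('o, 'm, 'p, 'n) cat_functor =
  on_obj :: "'o \<Rightarrow> 'p"
  on_arr :: "'o \<Rightarrow> 'o \<Rightarrow> 'm \<Rightarrow> 'n"

definition is_functor ::
    "('o, 'm) cat \<Rightarrow> ('p, 'n) cat \<Rightarrow> ('o, 'm, 'p, 'n) cat_functor \<Rightarrow> bool"
  where "is_functor C D F \<longleftrightarrow>
    (\<forall>a \<in> Obj C. on_obj F a \<in> Obj D) \<and>
    (\<forall>a \<in> Obj C. \<forall>b \<in> Obj C. \<forall>f \<in> Hom C a b.
       on_arr F a b f \<in> Hom D (on_obj F a) (on_obj F b)) \<and>
    (\<forall>a \<in> Obj C. on_arr F a a (Id C a) = Id D (on_obj F a)) \<and>
    (\<forall>a \<in> Obj C. \<forall>b \<in> Obj C. \<forall>c \<in> Obj C. \<forall>f \<in> Hom C a b. \<forall>g \<in> Hom C b c.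
       on_arr F a c (Comp C a b c g f) =
       Comp D (on_obj F a) (on_obj F b) (on_obj F c) (on_arr F b c g) (on_arr F a b f))"

definition id_functor :: "('o, 'm, 'o, 'm) cat_functor"
  where "id_functor = \<lparr>on_obj = (\<lambda>a. a), on_arr = (\<lambda>a b f. f)\<rparr>"

definition comp_functor ::
    "('p, 'n, 'q, 'k) cat_functor \<Rightarrow> ('o, 'm, 'p, 'n) cat_functor \<Rightarrow> ('o, 'm, 'q, 'k) cat_functor"
  where "comp_functor G F =
    \<lparr>on_obj = (\<lambda>a. on_obj G (on_obj F a)),
     on_arr = (\<lambda>a b f. on_arr G (on_obj F a) (on_obj F b) (on_arr F a b f))\<rparr>"

definition is_invertible :: "('o, 'm) cat \<Rightarrow> 'o \<Rightarrow> 'o \<Rightarrow> 'm \<Rightarrow> bool"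
  where "is_invertible C a b f \<longleftrightarrow> f \<in> Hom C a b \<and>
    (\<exists>g \<in> Hom C b a. Comp C a b a g f = Id C a \<and> Comp C b a b f g = Id C b)"

definition is_natural_iso ::
    "('o, 'm) cat \<Rightarrow> ('p, 'n) cat \<Rightarrow> ('o, 'm, 'p, 'n) cat_functor \<Rightarrow>
     ('o, 'm, 'p, 'n) cat_functor \<Rightarrow> ('o \<Rightarrow> 'n) \<Rightarrow> bool"
  where "is_natural_iso C D F G \<eta> \<longleftrightarrow>
    (\<forall>a \<in> Obj C. is_invertible D (on_obj F a) (on_obj G a) (\<eta> a)) \<and>
    (\<forall>a \<in> Obj C. \<forall>b \<in> Obj C. \<forall>f \<in> Hom C a b.
       Comp D (on_obj F a) (on_obj F b) (on_obj G b) (\<eta> b) (on_arr F a b f) =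
       Comp D (on_obj F a) (on_obj G a) (on_obj G b) (on_arr G a b f) (\<eta> a))"

definition equivalent_categories :: "('o, 'm) cat \<Rightarrow> ('p, 'n) cat \<Rightarrow> bool"
  where "equivalent_categories C D \<longleftrightarrow> category C \<and> category D \<and>
    (\<exists>F G \<eta> \<theta>. is_functor C D F \<and> is_functor D C G \<and>
       is_natural_iso C C id_functor (comp_functor G F) \<eta> \<and>
       is_natural_iso D D (comp_functor F G) id_functor \<theta>)"


section \<open>Augmented directed complexes\<close>

text \<open>
  Following HOL-Algebra, abelian groups are commutative groups in multiplicative notation,
  so \<open>\<otimes>\<close> and \<open>\<one>\<close> stand for addition and zero, and \<open>b [^] n\<close> for the multiple \<open>n b\<close>.
\<close>

record 'a preordered_group = "'a monoid" +
  pre_le :: "'a \<Rightarrow> 'a \<Rightarrow> bool" (infix "\<preceq>\<index>" 50)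

locale preordered_abelian_group = comm_group A
  for A :: "('a, 'b) preordered_group_scheme" (structure) +
  assumes pre_le_refl: "a \<in> carrier A \<Longrightarrow> a \<preceq> a"
    and pre_le_trans: "\<lbrakk>a \<in> carrier A; b \<in> carrier A; c \<in> carrier A; a \<preceq> b; b \<preceq> c\<rbrakk> \<Longrightarrow> a \<preceq> c"
    and pre_le_mult: "\<lbrakk>a \<in> carrier A; b \<in> carrier A; c \<in> carrier A; a \<preceq> b\<rbrakk> \<Longrightarrow> a \<otimes> c \<preceq> b \<otimes> c"

definition positive_cone :: "('a, 'b) preordered_group_scheme \<Rightarrow> 'a set"
  where "positive_cone A = {a \<in> carrier A. \<one>\<^bsub>A\<^esub> \<preceq>\<^bsub>A\<^esub> a}"

definition finite_multisets :: "'a set \<Rightarrow> 'a multiset set"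
  where "finite_multisets B = {S. set_mset S \<subseteq> B}"

text \<open>
  A subset \<open>B\<close> of a commutative monoid (abelian group) is a basis if the homomorphism from the
  free commutative monoid (free abelian group) on \<open>B\<close> induced by the inclusion is bijective.
\<close>

definition monoid_basis :: "('a, 'b) monoid_scheme \<Rightarrow> 'a set \<Rightarrow> bool"
  where "monoid_basis M B \<longleftrightarrow> B \<subseteq> carrier M \<and>
    bij_betw (\<lambda>S. \<Otimes>\<^bsub>M\<^esub>b\<in>set_mset S. b [^]\<^bsub>M\<^esub> count S b) (finite_multisets B) (carrier M)"

definition group_basis :: "('a, 'b) monoid_scheme \<Rightarrow> 'a set \<Rightarrow> bool"
  where "group_basis A B \<longleftrightarrow> B \<subseteq> carrier A \<and>
    bij_betw (\<lambda>c. \<Otimes>\<^bsub>A\<^esub>b\<in>Poly_Mapping.keys c. b [^]\<^bsub>A\<^esub> Poly_Mapping.lookup c b)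
      (carrier (free_Abelian_group B)) (carrier A)"

definition preordered_group_basis :: "('a, 'b) preordered_group_scheme \<Rightarrow> 'a set \<Rightarrow> bool"
  where "preordered_group_basis A B \<longleftrightarrow>
    B \<subseteq> positive_cone A \<and> monoid_basis (A\<lparr>carrier := positive_cone A\<rparr>) B \<and> group_basis A B"

text \<open>
  The type variable \<open>'a\<close> is the universe: all underlying sets are subsets of \<open>'a\<close>. When it is
  infinite it has room for the free abelian group on any of its subsets. Values of group
  operations, preorders and boundaries off the carriers are unconstrained, which only adds
  isomorphic copies of objects.

  \<open>bd K n\<close> is the boundary from degree \<open>n + 1\<close> to degree \<open>n\<close>.
\<close>

record 'a directed_complex =
  gr :: "nat \<Rightarrow> 'a preordered_group"
  bd :: "nat \<Rightarrow> 'a \<Rightarrow> 'a"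

record 'a augmented_complex = "'a directed_complex" +
  aug :: "'a \<Rightarrow> int"

definition is_directed_complex :: "('a, 'b) directed_complex_scheme \<Rightarrow> bool"
  where "is_directed_complex K \<longleftrightarrow>
    (\<forall>n. preordered_abelian_group (gr K n)) \<and>
    (\<forall>n. bd K n \<in> hom (gr K (Suc n)) (gr K n)) \<and>
    (\<forall>n. \<forall>x \<in> carrier (gr K (Suc (Suc n))). bd K n (bd K (Suc n) x) = \<one>\<^bsub>gr K n\<^esub>)"

definition is_augmented_directed_complex :: "'a augmented_complex \<Rightarrow> bool"
  where "is_augmented_directed_complex K \<longleftrightarrow>
    is_directed_complex K \<and>
    aug K \<in> hom (gr K 0) integer_group \<and>
    (\<forall>x \<in> carrier (gr K 0). \<forall>y \<in> carrier (gr K 0). x \<preceq>\<^bsub>gr K 0\<^esub> y \<longrightarrow> aug K x \<le> aug K y) \<and>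
    (\<forall>x \<in> carrier (gr K 1). aug K (bd K 0 x) = 0)"

definition complex_basis ::
    "('a, 'b) directed_complex_scheme \<Rightarrow> (nat \<Rightarrow> 'a set) \<Rightarrow> bool"
  where "complex_basis K B \<longleftrightarrow> (\<forall>n. preordered_group_basis (gr K n) (B n))"

definition is_free_complex :: "('a, 'b) directed_complex_scheme \<Rightarrow> bool"
  where "is_free_complex K \<longleftrightarrow> (\<exists>B. complex_basis K B)"

text \<open>
  Morphisms, here and below, are extensional (undefined off the carriers), so that equality of
  HOL functions is equality of morphisms.
\<close>

definition directed_hom ::
    "('a, 'b) directed_complex_scheme \<Rightarrow> ('a, 'b) directed_complex_scheme \<Rightarrow> (nat \<Rightarrow> 'a \<Rightarrow> 'a) set"
  where "directed_hom K L = {f.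
    (\<forall>n. f n \<in> hom (gr K n) (gr L n) \<inter> extensional (carrier (gr K n))) \<and>
    (\<forall>n. \<forall>x \<in> carrier (gr K n). \<forall>y \<in> carrier (gr K n).
       x \<preceq>\<^bsub>gr K n\<^esub> y \<longrightarrow> f n x \<preceq>\<^bsub>gr L n\<^esub> f n y) \<and>
    (\<forall>n. \<forall>x \<in> carrier (gr K (Suc n)). f n (bd K n x) = bd L n (f (Suc n) x))}"

definition augmented_hom ::
    "'a augmented_complex \<Rightarrow> 'a augmented_complex \<Rightarrow> (nat \<Rightarrow> 'a \<Rightarrow> 'a) set"
  where "augmented_hom K L =
    {f \<in> directed_hom K L. \<forall>x \<in> carrier (gr K 0). aug L (f 0 x) = aug K x}"

definition ADC :: "('a augmented_complex, nat \<Rightarrow> 'a \<Rightarrow> 'a) cat"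
  where "ADC =
    \<lparr>Obj = {K. is_augmented_directed_complex K},
     Hom = augmented_hom,
     Id = (\<lambda>K n. \<lambda>x\<in>carrier (gr K n). x),
     Comp = (\<lambda>K L M g f n. compose (carrier (gr K n)) (g n) (f n))\<rparr>"

definition FreeADC :: "('a augmented_complex, nat \<Rightarrow> 'a \<Rightarrow> 'a) cat"
  where "FreeADC = full_subcategory ADC is_free_complex"


section \<open>Additive parity complexes\<close>

text \<open>
  For \<open>x \<in> cells B (n + 1)\<close>, the multisets \<open>src B n x\<close> and \<open>tgt B n x\<close> over \<open>cells B n\<close> are
  the source $\partial^- x$ and the target $\partial^+ x$. The multiset operations \<open>\<squnion>\<close> and
  \<open>\<setminus>\<close> of pointwise addition and truncated subtraction are \<open>+\<close> and \<open>-\<close> of the multiset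
  library, and \<open>\<inter>#\<close> is the pointwise minimum.
\<close>

record 'a parity_structure =
  cells :: "nat \<Rightarrow> 'a set"
  src :: "nat \<Rightarrow> 'a \<Rightarrow> 'a multiset"
  tgt :: "nat \<Rightarrow> 'a \<Rightarrow> 'a multiset"

definition is_parity_structure :: "'a parity_structure \<Rightarrow> bool"
  where "is_parity_structure B \<longleftrightarrow>
    (\<forall>n. \<forall>x \<in> cells B (Suc n).
       src B n x \<in> finite_multisets (cells B n) \<and>
       tgt B n x \<in> finite_multisets (cells B n) \<and>
       src B n x \<inter># tgt B n x = {#})"

definition extend :: "('a \<Rightarrow> 'b multiset) \<Rightarrow> 'a multiset \<Rightarrow> 'b multiset"
  where "extend f S = (\<Sum>x\<in>#S. f x)"

definition src_mset :: "'a parity_structure \<Rightarrow> nat \<Rightarrow> 'a multiset \<Rightarrow> 'a multiset"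
  where "src_mset B n S = extend (src B n) S - extend (tgt B n) S"

definition tgt_mset :: "'a parity_structure \<Rightarrow> nat \<Rightarrow> 'a multiset \<Rightarrow> 'a multiset"
  where "tgt_mset B n S = extend (tgt B n) S - extend (src B n) S"

definition is_parity_complex :: "'a parity_structure \<Rightarrow> bool"
  where "is_parity_complex B \<longleftrightarrow> is_parity_structure B \<and>
    (\<forall>n. \<forall>x \<in> cells B (Suc (Suc n)).
       src_mset B n (src B (Suc n) x) = src_mset B n (tgt B (Suc n) x) \<and>
       tgt_mset B n (src B (Suc n) x) = tgt_mset B n (tgt B (Suc n) x))"

definition moves ::
    "'a parity_structure \<Rightarrow> nat \<Rightarrow> 'a multiset \<Rightarrow> 'a multiset \<Rightarrow> 'a multiset \<Rightarrow> bool"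
  where "moves B n S M P \<longleftrightarrow> src_mset B n S = M - P \<and> tgt_mset B n S = P - M"

definition parity_hom ::
    "'a parity_structure \<Rightarrow> 'a parity_structure \<Rightarrow> (nat \<Rightarrow> 'a \<Rightarrow> 'a multiset) set"
  where "parity_hom B C = {f.
    (\<forall>n. f n \<in> cells B n \<rightarrow>\<^sub>E finite_multisets (cells C n)) \<and>
    (\<forall>n. \<forall>x \<in> cells B (Suc n).
       moves C n (f (Suc n) x) (extend (f n) (src B n x)) (extend (f n) (tgt B n x)))}"

definition APC :: "('a parity_structure, nat \<Rightarrow> 'a \<Rightarrow> 'a multiset) cat"
  where "APC =
    \<lparr>Obj = {B. is_parity_complex B},
     Hom = parity_hom,
     Id = (\<lambda>B n. \<lambda>x\<in>cells B n. {#x#}),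
     Comp = (\<lambda>B C D g f n. \<lambda>x\<in>cells B n. extend (g n) (f n x))\<rparr>"

text \<open>The complex $1[0]$, with \<open>pt\<close> as its only element.\<close>

definition point_complex :: "'a \<Rightarrow> 'a parity_structure"
  where "point_complex pt =
    \<lparr>cells = (\<lambda>n. if n = 0 then {pt} else {}), src = (\<lambda>_ _. {#}), tgt = (\<lambda>_ _. {#})\<rparr>"

end

theory Submission
  imports Defs
begin

text \<open>
  If \<open>K\<close> has a basis \<open>B\<close>, every element of \<open>K\<^sub>n\<close> is uniquely a difference of two disjoint
  multisets over \<open>B\<^sub>n\<close>. Writing the boundary of each basis element as such a difference
  turns \<open>B\<close> into a parity structure, and the augmentation, being a natural number on each basis
  element, becomes a map to \<open>1[0]\<close>. The truncated differences in the definition of \<open>moves\<close> and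
  of parity complexes are equivalent to equations without subtraction
  (\<open>a - b = c - d\<close> and \<open>b - a = d - c\<close> iff \<open>a + d = b + c\<close>), so that \<open>\<partial>\<partial> = 0\<close>, \<open>\<epsilon>\<partial> = 0\<close>
  and the chain map condition all become, on basis elements, the corresponding conditions for
  parity complexes. Monotone homomorphisms between free objects correspond to arbitrary assignments
  of multisets to basis elements, hence morphisms of complexes to morphisms over \<open>1[0]\<close>. Conversely
  every parity complex comes from the free abelian groups on its cells, which fit into the
  universe because it is infinite.
\<close>

section \<open>Equivalences from correspondences\<close>

lemma category_full_subcategory:
  assumes "category C"
  shows "category (full_subcategory C P)"
proof -
  interpret category C by fact
  show ?thesis
    by unfold_locales
      (auto simp: full_subcategory_def Id_in_Hom Comp_in_Hom Comp_Id_left Comp_Id_right Comp_assoc)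
qed

lemma category_slice:
  assumes "category C" and z: "z \<in> Obj C"
  shows "category (slice C z)"
proof -
  interpret category C by fact
  show ?thesis
  proof unfold_locales
    fix a b c f g
    assume "a \<in> Obj (slice C z)" "b \<in> Obj (slice C z)" "c \<in> Obj (slice C z)"
      "f \<in> Hom (slice C z) a b" "g \<in> Hom (slice C z) b c"
    then show "Comp (slice C z) a b c g f \<in> Hom (slice C z) a c"
      using z by (auto simp: slice_def Comp_in_Hom Comp_assoc)
  qed (use z in \<open>auto simp: slice_def Id_in_Hom Comp_Id_left Comp_Id_right Comp_assoc\<close>)
qed

text \<open>
  Each \<open>w \<in> W\<close> stands for a correspondence between \<open>l w\<close> and \<open>r w\<close>, and \<open>R v w f g\<close> says that the
  arrows \<open>f\<close> and \<open>g\<close> correspond. The unit and counit are the arrows that correspond to identities.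
\<close>

lemma equivalent_categories_if_correspondence:
  fixes C :: "('o, 'm) cat" and D :: "('p, 'n) cat" and W :: "'w set"
  assumes C: "category C" and D: "category D"
    and l: "l ` W = Obj C" and r: "r ` W = Obj D"
    and R1: "\<And>v w f. \<lbrakk>v \<in> W; w \<in> W; f \<in> Hom C (l v) (l w)\<rbrakk>
      \<Longrightarrow> \<exists>!g. g \<in> Hom D (r v) (r w) \<and> R v w f g"
    and R2: "\<And>v w g. \<lbrakk>v \<in> W; w \<in> W; g \<in> Hom D (r v) (r w)\<rbrakk>
      \<Longrightarrow> \<exists>!f. f \<in> Hom C (l v) (l w) \<and> R v w f g"
    and RId: "\<And>w. w \<in> W \<Longrightarrow> R w w (Id C (l w)) (Id D (r w))"
    and RComp: "\<And>u v w f g f' g'. \<lbrakk>u \<in> W; v \<in> W; w \<in> W;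
        f \<in> Hom C (l u) (l v); f' \<in> Hom D (r u) (r v); R u v f f';
        g \<in> Hom C (l v) (l w); g' \<in> Hom D (r v) (r w); R v w g g'\<rbrakk>
      \<Longrightarrow> R u w (Comp C (l u) (l v) (l w) g f) (Comp D (r u) (r v) (r w) g' f')"
  shows "equivalent_categories C D"
proof -
  interpret C: category C by fact
  interpret D: category D by fact
  \<comment> \<open>\<open>s\<close> and \<open>t\<close> choose an element of \<open>W\<close> over
    each object of \<open>C\<close> and of \<open>D\<close>, which is possible because
    \<open>l\<close> and \<open>r\<close> are onto. \<open>right\<close> and \<open>left\<close>
    transport arrows along the correspondence.\<close>
  define s where "s = inv_into W l"
  define t where "t = inv_into W r"
  define right where "right v w f = (THE g. g \<in> Hom D (r v) (r w) \<and> R v w f g)" for v w f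
  define left where "left v w g = (THE f. f \<in> Hom C (l v) (l w) \<and> R v w f g)" for v w g
  have right: "right v w f \<in> Hom D (r v) (r w)" "R v w f (right v w f)"
    if "v \<in> W" "w \<in> W" "f \<in> Hom C (l v) (l w)" for v w f
    using theI'[OF R1[OF that]] by (auto simp: right_def)
  have left: "left v w g \<in> Hom C (l v) (l w)" "R v w (left v w g) g"
    if "v \<in> W" "w \<in> W" "g \<in> Hom D (r v) (r w)" for v w g
    using theI'[OF R2[OF that]] by (auto simp: left_def)
  \<comment> \<open>All equations between arrows below come from \<open>right_eq\<close> and
    \<open>left_eq\<close>: two arrows that correspond to the same arrow of the other category
    coincide.\<close>
  have right_eq: "g = g'"
    if "v \<in> W" "w \<in> W" "f \<in> Hom C (l v) (l w)" "g \<in> Hom D (r v) (r w)" "g' \<in> Hom D (r v) (r w)"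
      "R v w f g" "R v w f g'" for v w f g g'
    using R1[OF that(1-3)] that by auto
  have left_eq: "f = f'"
    if "v \<in> W" "w \<in> W" "g \<in> Hom D (r v) (r w)" "f \<in> Hom C (l v) (l w)" "f' \<in> Hom C (l v) (l w)"
      "R v w f g" "R v w f' g" for v w f f' g
    using R2[OF that(1-3)] that by auto
  have lW: "l w \<in> Obj C" and rW: "r w \<in> Obj D" if "w \<in> W" for w
    using l r that by auto
  have sW: "s c \<in> W" "l (s c) = c" if "c \<in> Obj C" for c
    using l that by (auto simp: s_def inv_into_into f_inv_into_f)
  have tW: "t d \<in> W" "r (t d) = d" if "d \<in> Obj D" for d
    using r that by (auto simp: t_def inv_into_into f_inv_into_f)
  define F where "F = \<lparr>on_obj = (\<lambda>a. r (s a)), on_arr = (\<lambda>a b. right (s a) (s b))\<rparr>"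
  define G where "G = \<lparr>on_obj = (\<lambda>a. l (t a)), on_arr = (\<lambda>a b. left (t a) (t b))\<rparr>"
  \<comment> \<open>\<open>s a\<close> and \<open>t (r (s a))\<close> have the same image under
    \<open>r\<close>, so the identity there corresponds to an arrow from \<open>a\<close> to its
    image under \<open>G\<close> after \<open>F\<close>. \<open>\<eta>'\<close> is the same
    construction backwards; \<open>\<theta>\<close> and \<open>\<theta>'\<close> are the mirror
    images in \<open>D\<close>.\<close>
  define \<eta> where "\<eta> a = left (s a) (t (r (s a))) (Id D (r (s a)))" for a
  define \<eta>' where "\<eta>' a = left (t (r (s a))) (s a) (Id D (r (s a)))" for a
  define \<theta> where "\<theta> d = right (s (l (t d))) (t d) (Id C (l (t d)))" for d
  define \<theta>' where "\<theta>' d = right (t d) (s (l (t d))) (Id C (l (t d)))" for d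
  have Far: "right (s a) (s b) f \<in> Hom D (r (s a)) (r (s b))" "R (s a) (s b) f (right (s a) (s b) f)"
    if "a \<in> Obj C" "b \<in> Obj C" "f \<in> Hom C a b" for a b f
    using right[of "s a" "s b" f] sW that by auto
  have Gar: "left (t a) (t b) g \<in> Hom C (l (t a)) (l (t b))" "R (t a) (t b) (left (t a) (t b) g) g"
    if "a \<in> Obj D" "b \<in> Obj D" "g \<in> Hom D a b" for a b g
    using left[of "t a" "t b" g] tW that by auto
  have F: "is_functor C D F"
    unfolding is_functor_def
  proof (intro conjI ballI)
    fix a assume a: "a \<in> Obj C"
    show "on_obj F a \<in> Obj D" using a by (simp add: F_def sW rW)
    show "on_arr F a a (Id C a) = Id D (on_obj F a)"
      using right_eq[of "s a" "s a" "Id C a"] Far[OF a a C.Id_in_Hom[OF a]] RId[of "s a"] a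
      by (simp add: F_def sW rW C.Id_in_Hom D.Id_in_Hom)
    fix b assume b: "b \<in> Obj C"
    { fix f assume "f \<in> Hom C a b"
      then show "on_arr F a b f \<in> Hom D (on_obj F a) (on_obj F b)"
        using Far a b by (simp add: F_def) }
    fix c f g assume c: "c \<in> Obj C" and f: "f \<in> Hom C a b" and g: "g \<in> Hom C b c"
    note fg = C.Comp_in_Hom[OF a b c f g]
    \<comment> \<open>Both sides correspond to the composite in \<open>C\<close>, the right-hand one
      by \<open>RComp\<close>.\<close>
    have "right (s a) (s c) (Comp C a b c g f) =
        Comp D (r (s a)) (r (s b)) (r (s c)) (right (s b) (s c) g) (right (s a) (s b) f)"
    proof (rule right_eq[of "s a" "s c" "Comp C a b c g f"])
      show "R (s a) (s c) (Comp C a b c g f)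
          (Comp D (r (s a)) (r (s b)) (r (s c)) (right (s b) (s c) g) (right (s a) (s b) f))"
        using RComp[of "s a" "s b" "s c", OF _ _ _ _ _ Far(2)[OF a b f] _ _ Far(2)[OF b c g]]
          Far(1)[OF a b f] Far(1)[OF b c g] f g by (simp add: sW a b c)
    qed (use Far[OF a c fg] Far(1)[OF a b f] Far(1)[OF b c g] fg a b c in
        \<open>auto simp: sW rW intro!: D.Comp_in_Hom\<close>)
    then show "on_arr F a c (Comp C a b c g f) =
      Comp D (on_obj F a) (on_obj F b) (on_obj F c) (on_arr F b c g) (on_arr F a b f)"
      by (simp add: F_def)
  qed
  have G: "is_functor D C G"
    unfolding is_functor_def
  proof (intro conjI ballI)
    fix a assume a: "a \<in> Obj D"
    show "on_obj G a \<in> Obj C" using a by (simp add: G_def tW lW)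
    show "on_arr G a a (Id D a) = Id C (on_obj G a)"
      using left_eq[of "t a" "t a" "Id D a"] Gar[OF a a D.Id_in_Hom[OF a]] RId[of "t a"] a
      by (simp add: G_def tW lW C.Id_in_Hom D.Id_in_Hom)
    fix b assume b: "b \<in> Obj D"
    { fix f assume "f \<in> Hom D a b"
      then show "on_arr G a b f \<in> Hom C (on_obj G a) (on_obj G b)"
        using Gar a b by (simp add: G_def) }
    fix c f g assume c: "c \<in> Obj D" and f: "f \<in> Hom D a b" and g: "g \<in> Hom D b c"
    note fg = D.Comp_in_Hom[OF a b c f g]
    have "left (t a) (t c) (Comp D a b c g f) =
        Comp C (l (t a)) (l (t b)) (l (t c)) (left (t b) (t c) g) (left (t a) (t b) f)"
    proof (rule left_eq[of "t a" "t c" "Comp D a b c g f"])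
      show "R (t a) (t c)
          (Comp C (l (t a)) (l (t b)) (l (t c)) (left (t b) (t c) g) (left (t a) (t b) f)) (Comp D a b c g f)"
        using RComp[of "t a" "t b" "t c", OF _ _ _ _ _ Gar(2)[OF a b f] _ _ Gar(2)[OF b c g]]
          Gar(1)[OF a b f] Gar(1)[OF b c g] f g by (simp add: tW a b c)
    qed (use Gar[OF a c fg] Gar(1)[OF a b f] Gar(1)[OF b c g] fg a b c in
        \<open>auto simp: tW lW intro!: C.Comp_in_Hom\<close>)
    then show "on_arr G a c (Comp D a b c g f) =
      Comp C (on_obj G a) (on_obj G b) (on_obj G c) (on_arr G b c g) (on_arr G a b f)"
      by (simp add: G_def)
  qed
  have \<eta>: "is_natural_iso C C id_functor (comp_functor G F) \<eta>"
    unfolding is_natural_iso_def is_invertible_def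
  proof (intro conjI ballI)
    have \<eta>_arr: "\<eta> a \<in> Hom C a (l (t (r (s a))))" "R (s a) (t (r (s a))) (\<eta> a) (Id D (r (s a)))"
      and \<eta>'_arr: "\<eta>' a \<in> Hom C (l (t (r (s a)))) a"
        "R (t (r (s a))) (s a) (\<eta>' a) (Id D (r (s a)))"
      if "a \<in> Obj C" for a
      using left[of "s a" "t (r (s a))" "Id D (r (s a))"]
        left[of "t (r (s a))" "s a" "Id D (r (s a))"] that
      by (auto simp: \<eta>_def \<eta>'_def sW tW rW D.Id_in_Hom)
    fix a assume a: "a \<in> Obj C"
    let ?b = "t (r (s a))"
    have W: "s a \<in> W" "?b \<in> W" "l (s a) = a" "r ?b = r (s a)" "r (s a) \<in> Obj D" "l ?b \<in> Obj C"
      by (auto simp: sW tW rW lW a)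
    note I = D.Id_in_Hom[OF W(5)]
    show "\<eta> a \<in> Hom C (on_obj id_functor a) (on_obj (comp_functor G F) a)"
      using \<eta>_arr a by (simp add: id_functor_def comp_functor_def F_def G_def)
    show "\<exists>g\<in>Hom C (on_obj (comp_functor G F) a) (on_obj id_functor a).
            Comp C (on_obj id_functor a) (on_obj (comp_functor G F) a) (on_obj id_functor a) g (\<eta> a) =
            Id C (on_obj id_functor a) \<and>
            Comp C (on_obj (comp_functor G F) a) (on_obj id_functor a) (on_obj (comp_functor G F) a)
             (\<eta> a) g = Id C (on_obj (comp_functor G F) a)"
    proof (intro bexI conjI)
      show "\<eta>' a \<in> Hom C (on_obj (comp_functor G F) a) (on_obj id_functor a)"
        using \<eta>'_arr a by (simp add: id_functor_def comp_functor_def F_def G_def)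
      \<comment> \<open>By \<open>RComp\<close> the composite corresponds to an identity of
        \<open>D\<close> composed with itself, that is, to the arrow to which \<open>Id C a\<close>
        also corresponds.\<close>
      have "Comp C a (l ?b) a (\<eta>' a) (\<eta> a) = Id C a"
        using RComp[of "s a" ?b "s a", OF _ _ _ _ _ \<eta>_arr(2) _ _ \<eta>'_arr(2)] \<eta>_arr(1) \<eta>'_arr(1)
          RId[of "s a"] W I a
        by (intro left_eq[of "s a" "s a" "Id D (r (s a))"])
          (auto simp: C.Id_in_Hom C.Comp_in_Hom D.Comp_Id_left)
      then show "Comp C (on_obj id_functor a) (on_obj (comp_functor G F) a) (on_obj id_functor a)
          (\<eta>' a) (\<eta> a) = Id C (on_obj id_functor a)"
        by (simp add: id_functor_def comp_functor_def F_def G_def)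
      have "Comp C (l ?b) a (l ?b) (\<eta> a) (\<eta>' a) = Id C (l ?b)"
        using RComp[of ?b "s a" ?b, OF _ _ _ _ _ \<eta>'_arr(2) _ _ \<eta>_arr(2)] \<eta>_arr(1) \<eta>'_arr(1)
          RId[of ?b] W I a
        by (intro left_eq[of ?b ?b "Id D (r (s a))"])
          (auto simp: C.Id_in_Hom C.Comp_in_Hom D.Comp_Id_left)
      then show "Comp C (on_obj (comp_functor G F) a) (on_obj id_functor a)
          (on_obj (comp_functor G F) a) (\<eta> a) (\<eta>' a) = Id C (on_obj (comp_functor G F) a)"
        by (simp add: id_functor_def comp_functor_def F_def G_def)
    qed
    fix b f assume b: "b \<in> Obj C" and f: "f \<in> Hom C a b"
    let ?h = "right (s a) (s b) f" and ?c = "t (r (s b))"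
    have Wb: "s b \<in> W" "?c \<in> W" "l (s b) = b" "r ?c = r (s b)" "r (s b) \<in> Obj D" "l ?c \<in> Obj C"
      by (auto simp: sW tW rW lW b)
    note h = Far[OF a b f]
    note h' = Gar[OF W(5) Wb(5) h(1)]
    \<comment> \<open>The partners of \<open>\<eta>\<close> in \<open>D\<close> are identities, so
      both sides of the naturality square correspond to \<open>?h\<close>.\<close>
    have "Comp C a b (l ?c) (\<eta> b) f = Comp C a (l ?b) (l ?c) (left ?b ?c ?h) (\<eta> a)"
    proof (rule left_eq[of "s a" ?c ?h])
      show "R (s a) ?c (Comp C a b (l ?c) (\<eta> b) f) ?h"
        using RComp[of "s a" "s b" ?c, OF _ _ _ _ _ h(2) _ _ \<eta>_arr(2)[OF b]]
          W Wb h f \<eta>_arr(1)[OF b] by (simp add: D.Comp_Id_left D.Id_in_Hom)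
      show "R (s a) ?c (Comp C a (l ?b) (l ?c) (left ?b ?c ?h) (\<eta> a)) ?h"
        using RComp[of "s a" ?b ?c, OF _ _ _ _ _ \<eta>_arr(2)[OF a] _ _ h'(2)]
          W Wb h h' f \<eta>_arr(1)[OF a] by (simp add: D.Comp_Id_right D.Id_in_Hom)
    qed (use a b W Wb h h' f \<eta>_arr(1) in \<open>auto intro!: C.Comp_in_Hom\<close>)
    then show "Comp C (on_obj id_functor a) (on_obj id_functor b) (on_obj (comp_functor G F) b) (\<eta> b)
        (on_arr id_functor a b f) =
        Comp C (on_obj id_functor a) (on_obj (comp_functor G F) a) (on_obj (comp_functor G F) b)
        (on_arr (comp_functor G F) a b f) (\<eta> a)"
      by (simp add: id_functor_def comp_functor_def F_def G_def)
  qed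
  have \<theta>: "is_natural_iso D D (comp_functor F G) id_functor \<theta>"
    unfolding is_natural_iso_def is_invertible_def
  proof (intro conjI ballI)
    have \<theta>_arr: "\<theta> a \<in> Hom D (r (s (l (t a)))) a" "R (s (l (t a))) (t a) (Id C (l (t a))) (\<theta> a)"
      and \<theta>'_arr: "\<theta>' a \<in> Hom D a (r (s (l (t a))))"
        "R (t a) (s (l (t a))) (Id C (l (t a))) (\<theta>' a)"
      if "a \<in> Obj D" for a
      using right[of "s (l (t a))" "t a" "Id C (l (t a))"]
        right[of "t a" "s (l (t a))" "Id C (l (t a))"] that
      by (auto simp: \<theta>_def \<theta>'_def sW tW lW C.Id_in_Hom)
    fix a assume a: "a \<in> Obj D"
    let ?b = "s (l (t a))"
    have W: "t a \<in> W" "?b \<in> W" "r (t a) = a" "l ?b = l (t a)" "l (t a) \<in> Obj C" "r ?b \<in> Obj D"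
      by (auto simp: sW tW rW lW a)
    note I = C.Id_in_Hom[OF W(5)]
    show "\<theta> a \<in> Hom D (on_obj (comp_functor F G) a) (on_obj id_functor a)"
      using \<theta>_arr a by (simp add: id_functor_def comp_functor_def F_def G_def)
    show "\<exists>g\<in>Hom D (on_obj id_functor a) (on_obj (comp_functor F G) a).
            Comp D (on_obj (comp_functor F G) a) (on_obj id_functor a) (on_obj (comp_functor F G) a) g (\<theta> a) =
            Id D (on_obj (comp_functor F G) a) \<and>
            Comp D (on_obj id_functor a) (on_obj (comp_functor F G) a) (on_obj id_functor a)
             (\<theta> a) g = Id D (on_obj id_functor a)"
    proof (intro bexI conjI)
      show "\<theta>' a \<in> Hom D (on_obj id_functor a) (on_obj (comp_functor F G) a)"
        using \<theta>'_arr a by (simp add: id_functor_def comp_functor_def F_def G_def)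
      have "Comp D a (r ?b) a (\<theta> a) (\<theta>' a) = Id D a"
        using RComp[of "t a" ?b "t a", OF _ _ _ _ _ \<theta>'_arr(2) _ _ \<theta>_arr(2)] \<theta>_arr(1) \<theta>'_arr(1)
          RId[of "t a"] W I a
        by (intro right_eq[of "t a" "t a" "Id C (l (t a))"])
          (auto simp: D.Id_in_Hom D.Comp_in_Hom C.Comp_Id_left)
      then show "Comp D (on_obj id_functor a) (on_obj (comp_functor F G) a) (on_obj id_functor a)
          (\<theta> a) (\<theta>' a) = Id D (on_obj id_functor a)"
        by (simp add: id_functor_def comp_functor_def F_def G_def)
      have "Comp D (r ?b) a (r ?b) (\<theta>' a) (\<theta> a) = Id D (r ?b)"
        using RComp[of ?b "t a" ?b, OF _ _ _ _ _ \<theta>_arr(2) _ _ \<theta>'_arr(2)] \<theta>_arr(1) \<theta>'_arr(1)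
          RId[of ?b] W I a
        by (intro right_eq[of ?b ?b "Id C (l (t a))"])
          (auto simp: D.Id_in_Hom D.Comp_in_Hom C.Comp_Id_left)
      then show "Comp D (on_obj (comp_functor F G) a) (on_obj id_functor a)
          (on_obj (comp_functor F G) a) (\<theta>' a) (\<theta> a) = Id D (on_obj (comp_functor F G) a)"
        by (simp add: id_functor_def comp_functor_def F_def G_def)
    qed
    fix b f assume b: "b \<in> Obj D" and f: "f \<in> Hom D a b"
    let ?h = "left (t a) (t b) f" and ?c = "s (l (t b))"
    have Wb: "t b \<in> W" "?c \<in> W" "r (t b) = b" "l ?c = l (t b)" "l (t b) \<in> Obj C" "r ?c \<in> Obj D"
      by (auto simp: sW tW rW lW b)
    note h = Gar[OF a b f]
    note h' = Far[OF W(5) Wb(5) h(1)]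
    have "Comp D (r ?b) (r ?c) b (\<theta> b) (right ?b ?c ?h) = Comp D (r ?b) a b f (\<theta> a)"
    proof (rule right_eq[of ?b "t b" ?h])
      show "R ?b (t b) ?h (Comp D (r ?b) (r ?c) b (\<theta> b) (right ?b ?c ?h))"
        using RComp[of ?b ?c "t b", OF _ _ _ _ _ h'(2) _ _ \<theta>_arr(2)[OF b]]
          W Wb h h' f \<theta>_arr(1)[OF b] by (simp add: C.Comp_Id_left C.Id_in_Hom)
      show "R ?b (t b) ?h (Comp D (r ?b) a b f (\<theta> a))"
        using RComp[of ?b "t a" "t b", OF _ _ _ _ _ \<theta>_arr(2)[OF a] _ _ h(2)]
          W Wb h f \<theta>_arr(1)[OF a] by (simp add: C.Comp_Id_right C.Id_in_Hom)
    qed (use a b W Wb h h' f \<theta>_arr(1) in \<open>auto intro!: D.Comp_in_Hom\<close>)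
    then show "Comp D (on_obj (comp_functor F G) a) (on_obj (comp_functor F G) b) (on_obj id_functor b) (\<theta> b)
        (on_arr (comp_functor F G) a b f) =
        Comp D (on_obj (comp_functor F G) a) (on_obj id_functor a) (on_obj id_functor b)
        (on_arr id_functor a b f) (\<theta> a)"
      by (simp add: id_functor_def comp_functor_def F_def G_def)
  qed
  show ?thesis
    unfolding equivalent_categories_def using C D F G \<eta> \<theta> by blast
qed

section \<open>The category of additive parity complexes\<close>

lemma extend_empty [simp]: "extend f {#} = {#}"
  by (simp add: extend_def)

lemma extend_union [simp]: "extend f (S + T) = extend f S + extend f T"
  by (simp add: extend_def)

lemma extend_add_mset [simp]: "extend f (add_mset x S) = f x + extend f S"
  by (simp add: extend_def)

lemma extend_extend: "extend g (extend f S) = extend (\<lambda>x. extend g (f x)) S"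
  by (induction S) auto

lemma finite_multisets_simps [simp]:
  "{#} \<in> finite_multisets B"
  "add_mset x S \<in> finite_multisets B \<longleftrightarrow> x \<in> B \<and> S \<in> finite_multisets B"
  "S + T \<in> finite_multisets B \<longleftrightarrow> S \<in> finite_multisets B \<and> T \<in> finite_multisets B"
  by (auto simp: finite_multisets_def)

lemma finite_multisets_induct [consumes 1, case_names empty add]:
  assumes "S \<in> finite_multisets B" and "P {#}"
    and "\<And>x S. \<lbrakk>x \<in> B; S \<in> finite_multisets B; P S\<rbrakk> \<Longrightarrow> P (add_mset x S)"
  shows "P S"
  using assms(1) by (induction S) (auto intro: assms)

text \<open>Morphisms are \<open>undefined\<close> off the cells, so extensions are compared only on
  multisets over the cells.\<close>

lemma extend_cong:
  "\<lbrakk>S \<in> finite_multisets B; \<And>x. x \<in> B \<Longrightarrow> f x = g x\<rbrakk> \<Longrightarrow> extend f S = extend g S"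
  by (induction rule: finite_multisets_induct) auto

lemma extend_in_finite_multisets:
  "\<lbrakk>S \<in> finite_multisets B; \<And>x. x \<in> B \<Longrightarrow> f x \<in> finite_multisets C\<rbrakk>
    \<Longrightarrow> extend f S \<in> finite_multisets C"
  by (induction rule: finite_multisets_induct) auto

lemma extend_singleton: "extend (\<lambda>x. {#x#}) S = S"
  by (induction S) auto

text \<open>For naturals, \<open>a - b\<close> and \<open>b - a\<close> are the positive and the
  negative part of the integer difference, so the pair carries the same information as that
  difference.\<close>

lemma multiset_diffs_eq_iff:
  fixes A B C D :: "'a multiset"
  shows "A - B = C - D \<and> B - A = D - C \<longleftrightarrow> A + D = B + C"
proof -
  have *: "(a::nat) - b = c - d \<and> b - a = d - c \<longleftrightarrow> a + d = b + c" for a b c d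
    by arith
  show ?thesis
    by (simp only: multiset_eq_iff all_conj_distrib[symmetric] count_diff count_union *)
qed

text \<open>Read in the free abelian group: target minus source of \<open>S\<close> equals
  \<open>P\<close> minus \<open>M\<close>. Negative terms are moved across so that such equations
  can be added and cancelled.\<close>

lemma moves_iff:
  "moves C n S M P \<longleftrightarrow> extend (src C n) S + P = extend (tgt C n) S + M"
  unfolding moves_def src_mset_def tgt_mset_def by (rule multiset_diffs_eq_iff)

text \<open>This is \<open>\<partial>\<partial> = 0\<close> for the differential "target minus
  source", with the negative terms moved across.\<close>

lemma is_parity_complex_iff:
  "is_parity_complex B \<longleftrightarrow> is_parity_structure B \<and>
    (\<forall>n. \<forall>x \<in> cells B (Suc (Suc n)).
       extend (src B n) (src B (Suc n) x) + extend (tgt B n) (tgt B (Suc n) x) =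
       extend (tgt B n) (src B (Suc n) x) + extend (src B n) (tgt B (Suc n) x))"
  unfolding is_parity_complex_def src_mset_def tgt_mset_def multiset_diffs_eq_iff ..

section \<open>Morphisms of parity complexes and their composition\<close>

lemma parity_structureD:
  assumes "is_parity_structure B" "x \<in> cells B (Suc n)"
  shows "src B n x \<in> finite_multisets (cells B n)" "tgt B n x \<in> finite_multisets (cells B n)"
    "src B n x \<inter># tgt B n x = {#}"
  using assms by (auto simp: is_parity_structure_def)

lemma parity_hom_in_finite_multisets:
  "\<lbrakk>f \<in> parity_hom B C; x \<in> cells B n\<rbrakk> \<Longrightarrow> f n x \<in> finite_multisets (cells C n)"
  unfolding parity_hom_def by (blast dest: PiE_mem)

lemma parity_hom_extensional:
  "\<lbrakk>f \<in> parity_hom B C; x \<notin> cells B n\<rbrakk> \<Longrightarrow> f n x = undefined"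
  unfolding parity_hom_def by (blast dest: PiE_arb)

text \<open>In the subtraction-free form both sides are additive in the multiset, so the condition
  passes from cells to multisets by induction.\<close>

lemma parity_hom_moves:
  assumes "f \<in> parity_hom B C" "S \<in> finite_multisets (cells B (Suc n))"
  shows "extend (src C n) (extend (f (Suc n)) S) + extend (f n) (extend (tgt B n) S) =
    extend (tgt C n) (extend (f (Suc n)) S) + extend (f n) (extend (src B n) S)"
  using assms(2)
proof (induction rule: finite_multisets_induct)
  case (add x S)
  have "extend (src C n) (f (Suc n) x) + extend (f n) (tgt B n x) =
      extend (tgt C n) (f (Suc n) x) + extend (f n) (src B n x)"
    using assms(1) add(1) by (auto simp: parity_hom_def moves_iff)
  with add(3) show ?case
    by (simp add: ac_simps)
qed simp

text \<open>The condition of \<open>g\<close> at the multiset \<open>f (Suc n) x\<close> is added to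
  the image under \<open>g n\<close> of the condition of \<open>f\<close> at \<open>x\<close>;
  \<open>cancel\<close> removes the terms they share.\<close>

lemma parity_hom_compose:
  assumes B: "is_parity_structure B" and f: "f \<in> parity_hom B C" and g: "g \<in> parity_hom C D"
  shows "(\<lambda>n. \<lambda>x\<in>cells B n. extend (g n) (f n x)) \<in> parity_hom B D"
  unfolding parity_hom_def
proof (intro CollectI conjI allI ballI)
  fix n
  show "(\<lambda>x\<in>cells B n. extend (g n) (f n x)) \<in> cells B n \<rightarrow>\<^sub>E finite_multisets (cells D n)"
    by (auto intro!: extend_in_finite_multisets
        intro: parity_hom_in_finite_multisets[OF f] parity_hom_in_finite_multisets[OF g])
  fix x assume x: "x \<in> cells B (Suc n)"
  let ?h = "\<lambda>n. \<lambda>x\<in>cells B n. extend (g n) (f n x)"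
  have h: "extend (?h n) S = extend (g n) (extend (f n) S)"
    if "S \<in> finite_multisets (cells B n)" for S
    using extend_cong[OF that, of "?h n" "\<lambda>x. extend (g n) (f n x)"] by (simp add: extend_extend)
  have 1: "extend (src C n) (f (Suc n) x) + extend (f n) (tgt B n x) =
      extend (tgt C n) (f (Suc n) x) + extend (f n) (src B n x)"
    using f x by (auto simp: parity_hom_def moves_iff)
  have 2: "extend (src D n) (extend (g (Suc n)) (f (Suc n) x)) + extend (g n) (extend (tgt C n) (f (Suc n) x)) =
    extend (tgt D n) (extend (g (Suc n)) (f (Suc n) x)) + extend (g n) (extend (src C n) (f (Suc n) x))"
    using parity_hom_moves[OF g parity_hom_in_finite_multisets[OF f x]] .
  have 3: "extend (g n) (extend (src C n) (f (Suc n) x)) + extend (g n) (extend (f n) (tgt B n x)) =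
      extend (g n) (extend (tgt C n) (f (Suc n) x)) + extend (g n) (extend (f n) (src B n x))"
    using 1 by (metis extend_union)
  have cancel: "a + d' = b + c'"
    if "a + e = b + d" "d + d' = e + c'" for a b c' d d' e :: "'d multiset"
  proof (rule add_right_imp_eq)
    show "(a + d') + (d + e) = (b + c') + (d + e)"
      using arg_cong2[OF that, of "(+)"] by (simp only: ac_simps)
  qed
  show "moves D n (?h (Suc n) x) (extend (?h n) (src B n x)) (extend (?h n) (tgt B n x))"
    unfolding moves_iff using cancel[OF 2 3] x parity_structureD[OF B x] by (simp add: h)
qed

lemma category_APC: "category APC"
proof unfold_locales
  fix B :: "'a parity_structure" assume "B \<in> Obj APC"
  then have B: "is_parity_structure B" by (simp add: APC_def is_parity_complex_def)
  have "extend (\<lambda>x\<in>cells B n. {#x#}) S = S" if "S \<in> finite_multisets (cells B n)" for n S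
    using extend_cong[OF that, of "\<lambda>x\<in>cells B n. {#x#}" "\<lambda>x. {#x#}"] by (simp add: extend_singleton)
  then show "Id APC B \<in> Hom APC B B"
    using parity_structureD[OF B]
    by (auto simp: APC_def parity_hom_def moves_iff add.commute)
next
  fix B C D :: "'a parity_structure" and f g
  assume "B \<in> Obj APC" "f \<in> Hom APC B C" "g \<in> Hom APC C D"
  then show "Comp APC B C D g f \<in> Hom APC B D"
    using parity_hom_compose by (auto simp: APC_def is_parity_complex_def)
next
  fix B C :: "'a parity_structure" and f
  assume f: "f \<in> Hom APC B C"
  then have f: "f \<in> parity_hom B C" by (simp add: APC_def)
  have "extend (\<lambda>x\<in>cells C n. {#x#}) S = S" if "S \<in> finite_multisets (cells C n)" for n S
    using extend_cong[OF that, of "\<lambda>x\<in>cells C n. {#x#}" "\<lambda>x. {#x#}"] by (simp add: extend_singleton)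
  then show "Comp APC B C C (Id APC C) f = f"
    using parity_hom_in_finite_multisets[OF f] parity_hom_extensional[OF f]
    by (intro ext) (simp add: APC_def restrict_def)
  show "Comp APC B B C f (Id APC B) = f"
    using parity_hom_extensional[OF f]
    by (intro ext) (simp add: APC_def restrict_def)
next
  fix B C D E :: "'a parity_structure" and f g h
  assume "f \<in> Hom APC B C" "g \<in> Hom APC C D" "h \<in> Hom APC D E"
  then have f: "f \<in> parity_hom B C" by (simp add: APC_def)
  have "extend (\<lambda>x\<in>cells C n. extend (h n) (g n x)) S = extend (h n) (extend (g n) S)"
    if "S \<in> finite_multisets (cells C n)" for n S
    using extend_cong[OF that, of "\<lambda>x\<in>cells C n. extend (h n) (g n x)" "\<lambda>x. extend (h n) (g n x)"]
    by (simp add: extend_extend)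
  then show "Comp APC B D E h (Comp APC B C D g f) = Comp APC B C E (Comp APC C D E h g) f"
    using parity_hom_in_finite_multisets[OF f]
    by (intro ext) (simp add: APC_def restrict_def)
qed

lemma point_complex_in_APC: "point_complex pt \<in> Obj APC"
  by (auto simp: APC_def is_parity_complex_iff is_parity_structure_def point_complex_def
      split: if_splits)

section \<open>Free preordered abelian groups\<close>

definition frag_of_mset :: "'a multiset \<Rightarrow> 'a \<Rightarrow>\<^sub>0 int"
  where "frag_of_mset S = (\<Sum>x\<in>#S. frag_of x)"

lemma frag_of_mset_simps [simp]:
  "frag_of_mset {#} = 0"
  "frag_of_mset (add_mset x S) = frag_of x + frag_of_mset S"
  "frag_of_mset (S + T) = frag_of_mset S + frag_of_mset T"
  by (simp_all add: frag_of_mset_def)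

lemma lookup_frag_of_mset [simp]: "Poly_Mapping.lookup (frag_of_mset S) x = int (count S x)"
  by (induction S) (auto simp: lookup_add)

lemma keys_frag_of_mset [simp]: "Poly_Mapping.keys (frag_of_mset S) = set_mset S"
  by (auto simp: Poly_Mapping.in_keys_iff)

lemma frag_of_mset_eq_iff [simp]: "frag_of_mset S = frag_of_mset T \<longleftrightarrow> S = T"
  by (metis lookup_frag_of_mset multiset_eqI of_nat_eq_iff)

lemma keys_subset_add [simp]:
  "\<lbrakk>Poly_Mapping.keys c \<subseteq> B; Poly_Mapping.keys d \<subseteq> B\<rbrakk> \<Longrightarrow> Poly_Mapping.keys (c + d) \<subseteq> B"
  using keys_add[of c d] by blast

text \<open>A generator is a difference with \<open>{#}\<close>, and a difference of differences
  regroups as a difference.\<close>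

lemma frag_as_difference:
  assumes "Poly_Mapping.keys c \<subseteq> B"
  shows "\<exists>S \<in> finite_multisets B. \<exists>T \<in> finite_multisets B. c + frag_of_mset T = frag_of_mset S"
  using assms
proof (induction rule: frag_induction)
  case zero
  show ?case by (intro bexI[of _ "{#}"]) auto
next
  case (one x)
  then show ?case by (intro bexI[of _ "{#}"] bexI[of _ "{#x#}"]) auto
next
  case (diff a b)
  then obtain S T S' T' where
    "S \<in> finite_multisets B" "T \<in> finite_multisets B" "a + frag_of_mset T = frag_of_mset S"
    "S' \<in> finite_multisets B" "T' \<in> finite_multisets B" "b + frag_of_mset T' = frag_of_mset S'"
    by blast
  then show ?case
    by (intro bexI[of _ "S + T'"] bexI[of _ "T + S'"]) (auto simp: algebra_simps)
qed

text \<open>Coefficients can cancel in \<open>c + d\<close>, so all three products are first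
  extended by trivial factors to the common index set \<open>?U\<close>. Evaluation of integer
  combinations is thereby a homomorphism.\<close>

lemma (in comm_group) finprod_frag_add:
  fixes c d :: "'a \<Rightarrow>\<^sub>0 int"
  assumes "Poly_Mapping.keys c \<subseteq> carrier G" "Poly_Mapping.keys d \<subseteq> carrier G"
  shows "(\<Otimes>b\<in>Poly_Mapping.keys (c + d). b [^] Poly_Mapping.lookup (c + d) b) =
    (\<Otimes>b\<in>Poly_Mapping.keys c. b [^] Poly_Mapping.lookup c b) \<otimes>
    (\<Otimes>b\<in>Poly_Mapping.keys d. b [^] Poly_Mapping.lookup d b)"
proof -
  let ?U = "Poly_Mapping.keys c \<union> Poly_Mapping.keys d"
  have *: "(\<Otimes>b\<in>Poly_Mapping.keys e. b [^] Poly_Mapping.lookup e b) =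
      (\<Otimes>b\<in>?U. b [^] Poly_Mapping.lookup e b)" if "Poly_Mapping.keys e \<subseteq> ?U" for e :: "'a \<Rightarrow>\<^sub>0 int"
    using assms that by (intro finprod_mono_neutral_cong_left) (auto simp: Poly_Mapping.in_keys_iff)
  have "(\<Otimes>b\<in>Poly_Mapping.keys (c + d). b [^] Poly_Mapping.lookup (c + d) b) =
      (\<Otimes>b\<in>?U. b [^] Poly_Mapping.lookup c b \<otimes> b [^] Poly_Mapping.lookup d b)"
    unfolding *[OF keys_add]
    using assms by (intro finprod_cong') (auto simp: lookup_add int_pow_mult)
  also have "\<dots> = (\<Otimes>b\<in>?U. b [^] Poly_Mapping.lookup c b) \<otimes> (\<Otimes>b\<in>?U. b [^] Poly_Mapping.lookup d b)"
    using assms by (intro finprod_multf) auto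
  finally show ?thesis by (simp add: *)
qed

lemma (in comm_group) finprod_frag_closed:
  fixes c :: "'a \<Rightarrow>\<^sub>0 int"
  shows "Poly_Mapping.keys c \<subseteq> carrier G
    \<Longrightarrow> (\<Otimes>b\<in>Poly_Mapping.keys c. b [^] Poly_Mapping.lookup c b) \<in> carrier G"
  by (intro finprod_closed) auto

lemma (in monoid) nat_pow_carrier_update:
  "b [^]\<^bsub>G\<lparr>carrier := H\<rparr>\<^esub> (n :: nat) = b [^] n"
  by (induction n) simp_all

text \<open>Generators are abstract labels, and \<open>v\<close> evaluates multisets of labels.
  Keeping labels apart from group elements lets the cells of a parity complex serve unchanged as
  generators of a group whose elements are encoded otherwise. \<open>v_bij\<close> makes the
  positive cone free on the labels, and \<open>v_generates\<close> makes the group the group of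
  differences of its cone.\<close>

locale presented_group = preordered_abelian_group A for A (structure) +
  fixes B :: "'c set" and v :: "'c multiset \<Rightarrow> 'a"
  assumes v_empty: "v {#} = \<one>"
    and v_union: "\<lbrakk>S \<in> finite_multisets B; T \<in> finite_multisets B\<rbrakk> \<Longrightarrow> v (S + T) = v S \<otimes> v T"
    and v_bij: "bij_betw v (finite_multisets B) (positive_cone A)"
    and v_generates: "a \<in> carrier A
      \<Longrightarrow> \<exists>S \<in> finite_multisets B. \<exists>T \<in> finite_multisets B. a \<otimes> v T = v S"
begin

lemma v_positive: "S \<in> finite_multisets B \<Longrightarrow> v S \<in> positive_cone A"
  using v_bij by (auto simp: bij_betw_def)

lemma v_closed [simp]: "S \<in> finite_multisets B \<Longrightarrow> v S \<in> carrier A"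
  using v_positive by (auto simp: positive_cone_def)

lemma v_eq_iff: "\<lbrakk>S \<in> finite_multisets B; T \<in> finite_multisets B\<rbrakk> \<Longrightarrow> v S = v T \<longleftrightarrow> S = T"
  using v_bij by (auto simp: bij_betw_def dest: inj_onD)

lemma v_surj: "a \<in> positive_cone A \<Longrightarrow> \<exists>S \<in> finite_multisets B. a = v S"
  using v_bij by (auto simp: bij_betw_def)

lemma v_add_mset:
  "\<lbrakk>x \<in> B; S \<in> finite_multisets B\<rbrakk> \<Longrightarrow> v (add_mset x S) = v {#x#} \<otimes> v S"
  using v_union[of "{#x#}" S] by simp

text \<open>Removing the common part \<open>S \<inter># T\<close> from both multisets makes them
  disjoint, as the source and target of a cell must be. In the conclusion \<open>S\<close> has the
  role of source and \<open>T\<close> that of target.\<close>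

lemma v_generates_disjoint:
  assumes "a \<in> carrier A"
  shows "\<exists>S \<in> finite_multisets B. \<exists>T \<in> finite_multisets B. S \<inter># T = {#} \<and> a \<otimes> v S = v T"
proof -
  obtain S T where ST: "S \<in> finite_multisets B" "T \<in> finite_multisets B" "a \<otimes> v T = v S"
    using v_generates[OF assms] by blast
  have I: "S \<inter># T \<in> finite_multisets B" "S - T \<in> finite_multisets B" "T - S \<in> finite_multisets B"
    using ST by (auto simp: finite_multisets_def dest: in_diffD)
  have "S = (S - T) + (S \<inter># T)" "T = (T - S) + (S \<inter># T)"
    by (auto simp: multiset_eq_iff)
  then have "v S = v (S - T) \<otimes> v (S \<inter># T)" "v T = v (T - S) \<otimes> v (S \<inter># T)"
    using v_union I by metis+
  then have "a \<otimes> v (T - S) = v (S - T)"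
    using ST assms I by (simp flip: m_assoc)
  moreover have "(T - S) \<inter># (S - T) = {#}"
    by (auto simp: multiset_eq_iff)
  ultimately show ?thesis using I by blast
qed

text \<open>Translation by \<open>inv a\<close> reduces the order to membership in the cone, whose
  elements are the values of \<open>v\<close>.\<close>

lemma le_iff:
  assumes "a \<in> carrier A" "b \<in> carrier A"
  shows "a \<preceq> b \<longleftrightarrow> (\<exists>S \<in> finite_multisets B. b = a \<otimes> v S)"
proof
  assume "a \<preceq> b"
  then have "a \<otimes> inv a \<preceq> b \<otimes> inv a" using assms by (intro pre_le_mult) auto
  then have "b \<otimes> inv a \<in> positive_cone A" using assms by (simp add: positive_cone_def)
  then obtain S where "S \<in> finite_multisets B" "b \<otimes> inv a = v S" using v_surj by blast
  then show "\<exists>S \<in> finite_multisets B. b = a \<otimes> v S"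
    using assms by (metis inv_closed inv_solve_right m_comm v_closed)
next
  assume "\<exists>S \<in> finite_multisets B. b = a \<otimes> v S"
  then obtain S where S: "S \<in> finite_multisets B" "b = a \<otimes> v S" by blast
  have "\<one> \<otimes> a \<preceq> v S \<otimes> a"
    using v_positive[OF S(1)] assms by (intro pre_le_mult) (auto simp: positive_cone_def)
  then show "a \<preceq> b" using S assms by (simp add: m_comm)
qed

text \<open>Agreement on generators extends to all values of \<open>v\<close> by induction, and
  every element is a quotient of two such values, so cancellation in \<open>G\<close>
  finishes.\<close>

lemma hom_eqI:
  assumes G: "group G" and f: "f \<in> hom A G" and g: "g \<in> hom A G"
    and eq: "\<And>x. x \<in> B \<Longrightarrow> f (v {#x#}) = g (v {#x#})" and a: "a \<in> carrier A"
  shows "f a = g a"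
proof -
  interpret G: group G by fact
  have *: "f (v S) = g (v S)" if "S \<in> finite_multisets B" for S
    using that
  proof (induction rule: finite_multisets_induct)
    case empty
    show ?case using hom_one[OF f _ G] hom_one[OF g _ G] by (simp add: v_empty is_group)
  next
    case (add x S)
    then show ?case
      by (simp add: v_add_mset[OF add(1,2)] hom_mult[OF f] hom_mult[OF g] eq)
  qed
  obtain S T where ST: "S \<in> finite_multisets B" "T \<in> finite_multisets B" "a \<otimes> v T = v S"
    using v_generates[OF a] by blast
  have "f a \<otimes>\<^bsub>G\<^esub> f (v T) = g a \<otimes>\<^bsub>G\<^esub> f (v T)"
    using *[OF ST(1)] *[OF ST(2)] hom_mult[OF f a, of "v T"] hom_mult[OF g a, of "v T"] ST by simp
  then show ?thesis
    using a ST hom_in_carrier[OF f] hom_in_carrier[OF g] by simp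
qed

text \<open>The universal property of the group of differences: with a representation of each
  \<open>a\<close> by multisets \<open>P a\<close> and \<open>N a\<close> chosen, \<open>f a\<close>
  is \<open>h (P a)\<close> divided by \<open>h (N a)\<close>.\<close>

lemma hom_extension:
  assumes G: "comm_group G"
    and h: "\<And>S. S \<in> finite_multisets B \<Longrightarrow> h S \<in> carrier G"
    and hU: "\<And>S T. \<lbrakk>S \<in> finite_multisets B; T \<in> finite_multisets B\<rbrakk> \<Longrightarrow> h (S + T) = h S \<otimes>\<^bsub>G\<^esub> h T"
  obtains f where "f \<in> hom A G" "f \<in> extensional (carrier A)"
    "\<And>S. S \<in> finite_multisets B \<Longrightarrow> f (v S) = h S"
proof -
  interpret G: comm_group G by fact
  obtain P N where PN: "\<And>a. a \<in> carrier A \<Longrightarrow> P a \<in> finite_multisets B"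
    "\<And>a. a \<in> carrier A \<Longrightarrow> N a \<in> finite_multisets B"
    "\<And>a. a \<in> carrier A \<Longrightarrow> a \<otimes> v (N a) = v (P a)"
    using v_generates by metis
  define f where "f = (\<lambda>a\<in>carrier A. h (P a) \<otimes>\<^bsub>G\<^esub> inv\<^bsub>G\<^esub> h (N a))"
  \<comment> \<open>The value does not depend on the chosen representation: injectivity of
    \<open>v\<close> turns two representations of \<open>a\<close> into the multiset identity
    \<open>S + N a = P a + T\<close>, to which \<open>h\<close> is applied.\<close>
  have f: "f a \<otimes>\<^bsub>G\<^esub> h T = h S"
    if "a \<in> carrier A" "S \<in> finite_multisets B" "T \<in> finite_multisets B" "a \<otimes> v T = v S" for a S T
  proof -
    have "v (S + N a) = v (P a + T)"
      using that PN[OF that(1)] by (metis m_ac(1) m_comm v_closed v_union)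
    then have "S + N a = P a + T"
      using that PN[OF that(1)] by (simp add: v_eq_iff)
    then have "h S \<otimes>\<^bsub>G\<^esub> h (N a) = h (P a) \<otimes>\<^bsub>G\<^esub> h T"
      using that PN[OF that(1)] hU by metis
    then show ?thesis
      using that PN[OF that(1)] h
      by (simp add: f_def) (metis G.inv_closed G.inv_solve_right G.m_assoc G.m_closed G.m_comm)
  qed
  show ?thesis
  proof
    have fc: "f a \<in> carrier G" if "a \<in> carrier A" for a
      using PN[OF that] that by (simp add: f_def h)
    show "f \<in> hom A G"
    proof (rule homI)
      fix a b assume ab: "a \<in> carrier A" "b \<in> carrier A"
      obtain S T where 1: "S \<in> finite_multisets B" "T \<in> finite_multisets B" "a \<otimes> v T = v S"
        using v_generates[OF ab(1)] by blast
      obtain S' T' where 2: "S' \<in> finite_multisets B" "T' \<in> finite_multisets B" "b \<otimes> v T' = v S'"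
        using v_generates[OF ab(2)] by blast
      have "(a \<otimes> b) \<otimes> v (T + T') = v (S + S')"
        using 1 2 ab by (simp add: v_union flip: 1(3) 2(3)) (simp add: m_ac)
      then have "f (a \<otimes> b) \<otimes>\<^bsub>G\<^esub> h (T + T') = h (S + S')"
        using 1 2 ab by (intro f) auto
      moreover have "(f a \<otimes>\<^bsub>G\<^esub> f b) \<otimes>\<^bsub>G\<^esub> h (T + T') = h (S + S')"
        using 1 2 ab h fc by (simp add: hU flip: f[OF ab(1) 1] f[OF ab(2) 2]) (simp add: G.m_ac)
      ultimately show "f (a \<otimes> b) = f a \<otimes>\<^bsub>G\<^esub> f b"
        using 1 2 ab h fc by (metis G.m_closed G.right_cancel finite_multisets_simps(3) m_closed)
    qed (use fc in auto)
    show "f \<in> extensional (carrier A)" by (simp add: f_def)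
    show "f (v S) = h S" if "S \<in> finite_multisets B" for S
    proof -
      \<comment> \<open>Additivity makes \<open>h {#}\<close> idempotent, hence neutral in a
        group.\<close>
      have "h {#} \<otimes>\<^bsub>G\<^esub> h {#} = h {#}" using hU[of "{#}" "{#}"] by simp
      then have "h {#} = \<one>\<^bsub>G\<^esub>" using h[of "{#}"] by simp
      then show ?thesis using f[of "v S" S "{#}"] that fc by (simp add: v_empty)
    qed
  qed
qed

end

section \<open>Bases versus presentations\<close>

lemma (in preordered_abelian_group) positive_cone_comm_monoid:
  "comm_monoid (A\<lparr>carrier := positive_cone A\<rparr>)"
proof -
  have "\<one> \<preceq> x \<otimes> y" if xy: "x \<in> positive_cone A" "y \<in> positive_cone A" for x y
    using pre_le_mult[of \<one> x y] pre_le_trans[of \<one> y "x \<otimes> y"] xy by (simp add: positive_cone_def)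
  then show ?thesis
    by unfold_locales (auto simp: positive_cone_def m_ac pre_le_refl)
qed

text \<open>Monoid bases multiply inside the cone with natural exponents, group bases in the whole
  group with integer exponents. This reconciles the two, so that one evaluation map serves for
  both.\<close>

lemma (in preordered_abelian_group) finprod_positive_cone:
  assumes B: "B \<subseteq> positive_cone A" and S: "S \<in> finite_multisets B"
  shows "(\<Otimes>\<^bsub>A\<lparr>carrier := positive_cone A\<rparr>\<^esub>b\<in>set_mset S. b [^]\<^bsub>A\<lparr>carrier := positive_cone A\<rparr>\<^esub> count S b) =
    (\<Otimes>\<^bsub>A\<^esub>b\<in>Poly_Mapping.keys (frag_of_mset S). b [^]\<^bsub>A\<^esub> Poly_Mapping.lookup (frag_of_mset S) b)"
proof -
  interpret M: comm_monoid "A\<lparr>carrier := positive_cone A\<rparr>"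
    by (rule positive_cone_comm_monoid)
  have "finprod (A\<lparr>carrier := positive_cone A\<rparr>) f X = finprod A f X"
    if "f \<in> X \<rightarrow> positive_cone A" "finite X" for f :: "'a \<Rightarrow> 'a" and X
    using that(2,1)
  proof (induction X)
    case (insert x X)
    moreover have "f \<in> insert x X \<rightarrow> carrier A"
      using insert(4) by (auto simp: positive_cone_def)
    ultimately show ?case by (simp add: M.finprod_insert Pi_iff)
  qed simp
  moreover have "b [^]\<^bsub>A\<^esub> n \<in> positive_cone A" if "b \<in> positive_cone A" for b and n :: nat
    using M.nat_pow_closed[of b n] that by (simp add: nat_pow_carrier_update)
  ultimately show ?thesis
    using S B by (simp add: nat_pow_carrier_update int_pow_int finite_multisets_def subset_iff)
qed

text \<open>\<open>v\<close> evaluates a multiset as an integer combination. The monoid half of the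
  basis property gives \<open>v_bij\<close>; surjectivity in the group half gives
  \<open>v_generates\<close>, since every combination is a difference of multisets.\<close>

lemma (in preordered_abelian_group) presented_group_if_basis:
  assumes B: "preordered_group_basis A B"
  shows "\<exists>v. presented_group A B v"
proof
  let ?c = "\<lambda>c. \<Otimes>\<^bsub>A\<^esub>b\<in>Poly_Mapping.keys c. b [^]\<^bsub>A\<^esub> Poly_Mapping.lookup c b"
  have Bc: "B \<subseteq> positive_cone A" "B \<subseteq> carrier A"
    using B by (auto simp: preordered_group_basis_def positive_cone_def)
  show "presented_group A B (\<lambda>S. ?c (frag_of_mset S))"
  proof unfold_locales
    fix S T assume "S \<in> finite_multisets B" "T \<in> finite_multisets B"
    then show "?c (frag_of_mset (S + T)) = ?c (frag_of_mset S) \<otimes> ?c (frag_of_mset T)"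
      unfolding frag_of_mset_simps using Bc
      by (intro finprod_frag_add) (auto simp: finite_multisets_def)
  next
    have "bij_betw (\<lambda>S. \<Otimes>\<^bsub>A\<lparr>carrier := positive_cone A\<rparr>\<^esub>b\<in>set_mset S.
        b [^]\<^bsub>A\<lparr>carrier := positive_cone A\<rparr>\<^esub> count S b) (finite_multisets B) (positive_cone A)"
      using B by (simp add: preordered_group_basis_def monoid_basis_def)
    then show "bij_betw (\<lambda>S. ?c (frag_of_mset S)) (finite_multisets B) (positive_cone A)"
      by (rule bij_betw_cong[THEN iffD1, rotated]) (rule finprod_positive_cone[OF Bc(1)])
  next
    fix a assume "a \<in> carrier A"
    moreover have "?c ` carrier (free_Abelian_group B) = carrier A"
      using B by (simp add: preordered_group_basis_def group_basis_def bij_betw_def)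
    ultimately have "a \<in> ?c ` carrier (free_Abelian_group B)" by blast
    then obtain c where c: "a = ?c c" "c \<in> carrier (free_Abelian_group B)" by (rule imageE)
    then have cB: "Poly_Mapping.keys c \<subseteq> B" by simp
    obtain S T where "S \<in> finite_multisets B" "T \<in> finite_multisets B"
      "c + frag_of_mset T = frag_of_mset S"
      using frag_as_difference[OF cB] by blast
    moreover from this have "?c (c + frag_of_mset T) = ?c c \<otimes> ?c (frag_of_mset T)"
      using cB Bc(2) by (intro finprod_frag_add) (auto simp: finite_multisets_def)
    ultimately show "\<exists>S \<in> finite_multisets B. \<exists>T \<in> finite_multisets B.
        a \<otimes> ?c (frag_of_mset T) = ?c (frag_of_mset S)"
      unfolding c(1) by metis
  qed simp
qed

text \<open>The cone half is \<open>v_bij\<close> transported along the relabelling of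
  \<open>x\<close> as \<open>v {#x#}\<close>. In the group half combinations are written as
  differences of multisets; uniqueness comes from injectivity of \<open>v\<close>, existence from
  \<open>v_generates\<close>.\<close>

lemma (in presented_group) basis:
  "preordered_group_basis A ((\<lambda>x. v {#x#}) ` B)"
proof -
  let ?b = "\<lambda>x. v {#x#}"
  let ?c = "\<lambda>c. \<Otimes>b\<in>Poly_Mapping.keys c. b [^] Poly_Mapping.lookup c b"
  have b: "?b ` B \<subseteq> positive_cone A" "?b ` B \<subseteq> carrier A"
    using v_positive by auto
  have inj: "inj_on ?b B"
    by (auto simp: inj_on_def v_eq_iff)
  have Mf: "finite_multisets (?b ` B) = image_mset ?b ` finite_multisets B"
  proof (intro equalityI subsetI)
    fix S assume "S \<in> finite_multisets (?b ` B)"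
    then show "S \<in> image_mset ?b ` finite_multisets B"
    proof (induction rule: finite_multisets_induct)
      case (add y S)
      then obtain x T where "x \<in> B" "y = ?b x" "T \<in> finite_multisets B" "S = image_mset ?b T"
        by blast
      then show ?case by (intro image_eqI[of _ _ "add_mset x T"]) auto
    qed simp
  next
    fix S assume "S \<in> image_mset ?b ` finite_multisets B"
    then show "S \<in> finite_multisets (?b ` B)"
      by (force simp: finite_multisets_def)
  qed
  \<comment> \<open>Evaluation after relabelling gives back \<open>v\<close>, so the properties of
    \<open>v\<close> carry over to \<open>?c\<close>.\<close>
  have cv: "?c (frag_of_mset (image_mset ?b S)) = v S" if "S \<in> finite_multisets B" for S
    using that
  proof (induction rule: finite_multisets_induct)
    case empty
    show ?case by (simp add: v_empty)
  next
    case (add x S)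
    have "?c (frag_of (?b x)) = ?b x"
      using add(1) by (simp add: finprod_singleton lookup_single int_pow_1)
    moreover have "set_mset (image_mset ?b S) \<subseteq> carrier A" "?b x \<in> carrier A"
      using add by (auto simp: finite_multisets_def)
    ultimately show ?case
      using add finprod_frag_add[of "frag_of (?b x)" "frag_of_mset (image_mset ?b S)"]
      by (simp add: v_add_mset[OF add(1,2)])
  qed
  have "bij_betw (\<lambda>S. ?c (frag_of_mset S)) (finite_multisets (?b ` B)) (positive_cone A)"
    unfolding bij_betw_def
  proof
    show "inj_on (\<lambda>S. ?c (frag_of_mset S)) (finite_multisets (?b ` B))"
      unfolding Mf by (auto simp: inj_on_def cv v_eq_iff simp del: keys_frag_of_mset lookup_frag_of_mset)
    have "(\<lambda>S. ?c (frag_of_mset S)) ` finite_multisets (?b ` B) = v ` finite_multisets B"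
      unfolding Mf image_image by (rule image_cong) (simp_all only: cv)
    then show "(\<lambda>S. ?c (frag_of_mset S)) ` finite_multisets (?b ` B) = positive_cone A"
      using v_bij by (simp add: bij_betw_def)
  qed
  then have 1: "monoid_basis (A\<lparr>carrier := positive_cone A\<rparr>) (?b ` B)"
    unfolding monoid_basis_def
    using b(1) bij_betw_cong[of "finite_multisets (?b ` B)", OF finprod_positive_cone[OF b(1)]]
    by auto
  \<comment> \<open>A combination is split by the same two multisets in the free abelian group and
    after evaluation.\<close>
  have dec: "\<exists>S \<in> finite_multisets B. \<exists>T \<in> finite_multisets B.
      c + frag_of_mset (image_mset ?b T) = frag_of_mset (image_mset ?b S) \<and> ?c c \<otimes> v T = v S"
    if c: "Poly_Mapping.keys c \<subseteq> ?b ` B" for c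
  proof -
    obtain S T where ST: "S \<in> finite_multisets B" "T \<in> finite_multisets B"
      "c + frag_of_mset (image_mset ?b T) = frag_of_mset (image_mset ?b S)"
      using frag_as_difference[OF c] unfolding Mf by blast
    have "?c (c + frag_of_mset (image_mset ?b T)) = ?c c \<otimes> ?c (frag_of_mset (image_mset ?b T))"
      using c b ST by (intro finprod_frag_add) (auto simp: finite_multisets_def)
    then have "?c c \<otimes> v T = v S"
      unfolding ST(3) cv[OF ST(1)] cv[OF ST(2)] by (rule sym)
    with ST show ?thesis by blast
  qed
  have 2: "group_basis A (?b ` B)"
    unfolding group_basis_def bij_betw_def
  proof (intro conjI inj_onI equalityI subsetI)
    fix c d assume cd: "c \<in> carrier (free_Abelian_group (?b ` B))"
      "d \<in> carrier (free_Abelian_group (?b ` B))" and eq: "?c c = ?c d"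
    have kc: "Poly_Mapping.keys c \<subseteq> ?b ` B" and kd: "Poly_Mapping.keys d \<subseteq> ?b ` B" using cd by auto
    obtain S T where ST: "S \<in> finite_multisets B" "T \<in> finite_multisets B"
      "c + frag_of_mset (image_mset ?b T) = frag_of_mset (image_mset ?b S)" "?c c \<otimes> v T = v S"
      using dec[OF kc] by blast
    obtain S' T' where ST': "S' \<in> finite_multisets B" "T' \<in> finite_multisets B"
      "d + frag_of_mset (image_mset ?b T') = frag_of_mset (image_mset ?b S')" "?c d \<otimes> v T' = v S'"
      using dec[OF kd] by blast
    have "?c c \<in> carrier A" using kc b by (intro finprod_frag_closed) auto
    \<comment> \<open>Equal values of \<open>c\<close> and \<open>d\<close> give equal cross sums,
      which injectivity of \<open>v\<close> reflects back to multisets.\<close>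
    then have "v (S + T') = v (S' + T)"
      using ST ST' eq by (simp add: v_union m_ac flip: ST(4) ST'(4))
    then have "S + T' = S' + T" using ST ST' by (simp add: v_eq_iff)
    then have "frag_of_mset (image_mset ?b S) + frag_of_mset (image_mset ?b T') =
        frag_of_mset (image_mset ?b S') + frag_of_mset (image_mset ?b T)"
      by (metis frag_of_mset_simps(3) image_mset_union)
    moreover have c: "c = frag_of_mset (image_mset ?b S) - frag_of_mset (image_mset ?b T)"
      using ST(3) by (simp only: eq_diff_eq)
    moreover have d: "d = frag_of_mset (image_mset ?b S') - frag_of_mset (image_mset ?b T')"
      using ST'(3) by (simp only: eq_diff_eq)
    ultimately show "c = d"
      unfolding c d by (simp only: diff_eq_eq diff_add_eq eq_diff_eq)
  next
    fix a assume a: "a \<in> carrier A"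
    then obtain S T where ST: "S \<in> finite_multisets B" "T \<in> finite_multisets B" "a \<otimes> v T = v S"
      using v_generates by blast
    let ?d = "frag_of_mset (image_mset ?b S) - frag_of_mset (image_mset ?b T)"
    have k: "Poly_Mapping.keys ?d \<subseteq> ?b ` B"
      using keys_diff[of "frag_of_mset (image_mset ?b S)" "frag_of_mset (image_mset ?b T)"] ST
      by (fastforce simp: finite_multisets_def)
    have "?c (?d + frag_of_mset (image_mset ?b T)) = ?c ?d \<otimes> ?c (frag_of_mset (image_mset ?b T))"
      using k b ST by (intro finprod_frag_add) (auto simp: finite_multisets_def)
    then have "v S = ?c ?d \<otimes> v T" using cv[OF ST(1)] cv[OF ST(2)] by simp
    with ST(3) have "a \<otimes> v T = ?c ?d \<otimes> v T" by (rule trans)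
    moreover have "?c ?d \<in> carrier A" using k b by (intro finprod_frag_closed) auto
    ultimately have "a = ?c ?d" using right_cancel[OF _ a] v_closed[OF ST(2)] by blast
    then show "a \<in> ?c ` carrier (free_Abelian_group (?b ` B))" using k by auto
  next
    fix a assume "a \<in> ?c ` carrier (free_Abelian_group (?b ` B))"
    then obtain c where c: "a = ?c c" "c \<in> carrier (free_Abelian_group (?b ` B))" by (rule imageE)
    show "a \<in> carrier A"
      unfolding c(1) using c(2) b(2) by (intro finprod_frag_closed) auto
  qed (use b in auto)
  show ?thesis
    unfolding preordered_group_basis_def using b 1 2 by blast
qed

section \<open>Presentations of augmented directed complexes\<close>

lemma category_ADC: "category ADC"
proof unfold_locales
  fix K :: "'a augmented_complex" assume "K \<in> Obj ADC"
  then have K: "comm_group (gr K n)" "bd K n \<in> hom (gr K (Suc n)) (gr K n)" for n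
    by (auto simp: ADC_def is_augmented_directed_complex_def is_directed_complex_def
        preordered_abelian_group_def)
  have "monoid (gr K n)" for n
    using K(1)[of n] by (simp add: comm_group_def comm_monoid_def)
  then show "Id ADC K \<in> Hom ADC K K"
    using hom_in_carrier[OF K(2)]
    by (auto simp: ADC_def augmented_hom_def directed_hom_def hom_def monoid.m_closed monoid.one_closed)
next
  fix K L M :: "'a augmented_complex" and f g
  assume K: "K \<in> Obj ADC" and f: "f \<in> Hom ADC K L" and g: "g \<in> Hom ADC L M"
  have bd: "bd K n \<in> hom (gr K (Suc n)) (gr K n)" and K': "monoid (gr K n)" for n
    using K by (auto simp: ADC_def is_augmented_directed_complex_def is_directed_complex_def
        preordered_abelian_group_def comm_group_def comm_monoid_def)
  have fh: "f n \<in> hom (gr K n) (gr L n)" and gh: "g n \<in> hom (gr L n) (gr M n)" for n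
    using f g by (auto simp: ADC_def augmented_hom_def directed_hom_def)
  have "compose (carrier (gr K n)) (g n) (f n) \<in> hom (gr K n) (gr M n)" for n
    using hom_compose[OF fh gh, of n] monoid.m_closed[OF K'[of n]]
    by (auto simp: hom_def compose_def Pi_iff)
  then show "Comp ADC K L M g f \<in> Hom ADC K M"
    using f g hom_in_carrier[OF bd] hom_in_carrier[OF fh]
    by (simp add: ADC_def augmented_hom_def directed_hom_def) (simp add: compose_def)
next
  fix K L :: "'a augmented_complex" and f
  assume "f \<in> Hom ADC K L"
  then have "f n \<in> carrier (gr K n) \<rightarrow> carrier (gr L n)" "f n \<in> extensional (carrier (gr K n))" for n
    by (auto simp: ADC_def augmented_hom_def directed_hom_def hom_def)
  then show "Comp ADC K L L (Id ADC L) f = f" "Comp ADC K K L f (Id ADC K) = f"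
    by (auto simp: ADC_def fun_eq_iff compose_def extensional_def Pi_iff)
next
  fix K L M N :: "'a augmented_complex" and f g h
  assume "f \<in> Hom ADC K L" "g \<in> Hom ADC L M" "h \<in> Hom ADC M N"
  then have "f n \<in> carrier (gr K n) \<rightarrow> carrier (gr L n)" for n
    by (auto simp: ADC_def augmented_hom_def directed_hom_def hom_def)
  then show "Comp ADC K M N h (Comp ADC K L M g f) = Comp ADC K L N (Comp ADC L M N h g) f"
    by (auto simp: ADC_def fun_eq_iff compose_def Pi_iff)
qed

text \<open>Multisets over one point are natural numbers; this links maps to \<open>1[0]\<close>
  with integer-valued augmentations.\<close>

lemma finite_multisets_singleton_eq_iff:
  assumes "S \<in> finite_multisets {a}" "T \<in> finite_multisets {a}"
  shows "S = T \<longleftrightarrow> count S a = count T a"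
proof -
  have "count S b = 0" "count T b = 0" if "b \<noteq> a" for b
    using assms that by (auto simp: finite_multisets_def count_eq_zero_iff)
  then show ?thesis by (metis multiset_eqI)
qed

lemma extend_const_empty [simp]: "extend (\<lambda>x. {#}) S = {#}"
  by (induction S) auto

text \<open>The locale records only how \<open>K\<close> and \<open>(P, p)\<close> match on
  generators; \<open>bd_v\<close> says that the boundary of a generator is target minus source. The
  conditions \<open>\<partial>\<partial> = 0\<close> and \<open>\<epsilon>\<partial> = 0\<close> and
  their counterparts for \<open>P\<close> and \<open>p\<close> are left open, so that they can be
  proved equivalent.\<close>

locale presentation =
  fixes pt :: 'u and K :: "'u augmented_complex" and P :: "'u parity_structure"
    and p :: "nat \<Rightarrow> 'u \<Rightarrow> 'u multiset" and v :: "nat \<Rightarrow> 'u multiset \<Rightarrow> 'u"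
  assumes pres: "presented_group (gr K n) (cells P n) (v n)"
    and parity: "is_parity_structure P"
    and bd_hom: "bd K n \<in> hom (gr K (Suc n)) (gr K n)"
    and bd_v: "x \<in> cells P (Suc n)
      \<Longrightarrow> bd K n (v (Suc n) {#x#}) \<otimes>\<^bsub>gr K n\<^esub> v n (src P n x) = v n (tgt P n x)"
    and p_fun: "p n \<in> cells P n \<rightarrow>\<^sub>E finite_multisets (cells (point_complex pt) n)"
    and aug_hom: "aug K \<in> hom (gr K 0) integer_group"
    and aug_v: "x \<in> cells P 0 \<Longrightarrow> aug K (v 0 {#x#}) = int (count (p 0 x) pt)"
begin

sublocale A: presented_group "gr K n" "cells P n" "v n" for n
  by (rule pres)

lemma p_0: "x \<in> cells P 0 \<Longrightarrow> p 0 x \<in> finite_multisets {pt}"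
  using PiE_mem[OF p_fun[of 0], of x] by (simp add: point_complex_def)

lemma p_Suc: "x \<in> cells P (Suc n) \<Longrightarrow> p (Suc n) x = {#}"
  using PiE_mem[OF p_fun[of "Suc n"], of x] by (simp add: point_complex_def finite_multisets_def)

lemma extend_p_0: "S \<in> finite_multisets (cells P 0) \<Longrightarrow> extend (p 0) S \<in> finite_multisets {pt}"
  by (rule extend_in_finite_multisets) (auto intro: p_0)

lemma extend_p_Suc: "S \<in> finite_multisets (cells P (Suc n)) \<Longrightarrow> extend (p (Suc n)) S = {#}"
  using extend_cong[of S "cells P (Suc n)" "p (Suc n)" "\<lambda>_. {#}"] by (simp add: p_Suc)

lemma extend_src: "S \<in> finite_multisets (cells P (Suc n))
    \<Longrightarrow> extend (src P n) S \<in> finite_multisets (cells P n)"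
  by (rule extend_in_finite_multisets) (auto intro: parity_structureD[OF parity])

lemma extend_tgt: "S \<in> finite_multisets (cells P (Suc n))
    \<Longrightarrow> extend (tgt P n) S \<in> finite_multisets (cells P n)"
  by (rule extend_in_finite_multisets) (auto intro: parity_structureD[OF parity])

section \<open>Boundary and augmentation conditions on generators\<close>

lemma bd_v_mset:
  assumes "S \<in> finite_multisets (cells P (Suc n))"
  shows "bd K n (v (Suc n) S) \<otimes>\<^bsub>gr K n\<^esub> v n (extend (src P n) S) = v n (extend (tgt P n) S)"
  using assms
proof (induction rule: finite_multisets_induct)
  case empty
  show ?case using hom_one[OF bd_hom[of n] A.is_group A.is_group] by (simp add: A.v_empty)
next
  case (add x S)
  have c: "bd K n (v (Suc n) S) \<in> carrier (gr K n)" "bd K n (v (Suc n) {#x#}) \<in> carrier (gr K n)"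
    using add(1,2) by (auto intro!: hom_in_carrier[OF bd_hom])
  have "bd K n (v (Suc n) (add_mset x S)) \<otimes>\<^bsub>gr K n\<^esub> v n (extend (src P n) (add_mset x S)) =
    (bd K n (v (Suc n) {#x#}) \<otimes>\<^bsub>gr K n\<^esub> v n (src P n x)) \<otimes>\<^bsub>gr K n\<^esub>
    (bd K n (v (Suc n) S) \<otimes>\<^bsub>gr K n\<^esub> v n (extend (src P n) S))"
    using add(1,2) c parity_structureD[OF parity add(1)] extend_src[OF add(2)]
    by (simp add: A.v_add_mset[OF add(1,2)] hom_mult[OF bd_hom] A.v_union A.m_ac)
  also have "\<dots> = v n (extend (tgt P n) (add_mset x S))"
    using add parity_structureD[OF parity add(1)] extend_tgt[OF add(2)]
    by (simp add: bd_v A.v_union)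
  finally show ?case .
qed

lemma aug_v_mset:
  assumes "S \<in> finite_multisets (cells P 0)"
  shows "aug K (v 0 S) = int (count (extend (p 0) S) pt)"
  using assms
proof (induction rule: finite_multisets_induct)
  case empty
  show ?case
    using hom_one[OF aug_hom A.is_group group_integer_group] by (simp add: A.v_empty)
next
  case (add x S)
  then show ?case
    using hom_mult[OF aug_hom, of "v 0 {#x#}" "v 0 S"] by (simp add: A.v_add_mset[OF add(1,2)] aug_v)
qed

text \<open>The double boundary is a homomorphism, so its vanishing can be tested on generators.
  There it expands into sources and targets of the source and target of \<open>x\<close>, and
  injectivity of \<open>v\<close> turns the vanishing into an equation of multisets.\<close>

lemma boundary_boundary_iff:
  "(\<forall>y \<in> carrier (gr K (Suc (Suc n))). bd K n (bd K (Suc n) y) = \<one>\<^bsub>gr K n\<^esub>) \<longleftrightarrow>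
   (\<forall>x \<in> cells P (Suc (Suc n)).
      extend (src P n) (src P (Suc n) x) + extend (tgt P n) (tgt P (Suc n) x) =
      extend (tgt P n) (src P (Suc n) x) + extend (src P n) (tgt P (Suc n) x))"
proof -
  have *: "bd K n (bd K (Suc n) (v (Suc (Suc n)) {#x#})) = \<one>\<^bsub>gr K n\<^esub> \<longleftrightarrow>
      extend (src P n) (src P (Suc n) x) + extend (tgt P n) (tgt P (Suc n) x) =
      extend (tgt P n) (src P (Suc n) x) + extend (src P n) (tgt P (Suc n) x)"
    if x: "x \<in> cells P (Suc (Suc n))" for x
  proof -
    define s t y where "s = src P (Suc n) x" and "t = tgt P (Suc n) x"
      and "y = bd K (Suc n) (v (Suc (Suc n)) {#x#})"
    have st: "s \<in> finite_multisets (cells P (Suc n))" "t \<in> finite_multisets (cells P (Suc n))"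
      using parity_structureD[OF parity x] by (auto simp: s_def t_def)
    have y: "y \<in> carrier (gr K (Suc n))"
      using x by (auto simp: y_def intro!: hom_in_carrier[OF bd_hom])
    note c = hom_in_carrier[OF bd_hom y] hom_in_carrier[OF bd_hom A.v_closed[OF st(1)]]
      A.v_closed[OF extend_src[OF st(1)]] A.v_closed[OF extend_src[OF st(2)]]
      A.v_closed[OF extend_tgt[OF st(1)]] A.v_closed[OF extend_tgt[OF st(2)]]
    have "bd K n (y \<otimes>\<^bsub>gr K (Suc n)\<^esub> v (Suc n) s) = bd K n (v (Suc n) t)"
      using bd_v[OF x] by (simp add: y_def s_def t_def)
    then have 1: "bd K n y \<otimes>\<^bsub>gr K n\<^esub> bd K n (v (Suc n) s) = bd K n (v (Suc n) t)"
      using y st by (simp add: hom_mult[OF bd_hom])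
    \<comment> \<open>The double boundary is the boundary of \<open>t\<close> minus that of
      \<open>s\<close>. Adding its negative terms, the target of \<open>s\<close> and the source of
      \<open>t\<close>, makes it a value of \<open>v\<close>.\<close>
    have "bd K n y \<otimes>\<^bsub>gr K n\<^esub> v n (extend (tgt P n) s + extend (src P n) t) =
      (bd K n y \<otimes>\<^bsub>gr K n\<^esub> bd K n (v (Suc n) s)) \<otimes>\<^bsub>gr K n\<^esub> v n (extend (src P n) t)
        \<otimes>\<^bsub>gr K n\<^esub> v n (extend (src P n) s)"
      using c st by (simp add: A.v_union extend_src extend_tgt A.m_ac flip: bd_v_mset[OF st(1)])
    also have "\<dots> = v n (extend (tgt P n) t) \<otimes>\<^bsub>gr K n\<^esub> v n (extend (src P n) s)"
      unfolding 1 bd_v_mset[OF st(2)] ..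
    also have "\<dots> = v n (extend (src P n) s + extend (tgt P n) t)"
      using st c by (simp add: A.v_union extend_src extend_tgt A.m_comm)
    finally have 2: "bd K n y \<otimes>\<^bsub>gr K n\<^esub> v n (extend (tgt P n) s + extend (src P n) t) =
      v n (extend (src P n) s + extend (tgt P n) t)" .
    have m: "extend (tgt P n) s + extend (src P n) t \<in> finite_multisets (cells P n)"
      "extend (src P n) s + extend (tgt P n) t \<in> finite_multisets (cells P n)"
      using st by (simp_all add: extend_src extend_tgt)
    have "bd K n y = \<one>\<^bsub>gr K n\<^esub> \<longleftrightarrow>
      bd K n y \<otimes>\<^bsub>gr K n\<^esub> v n (extend (tgt P n) s + extend (src P n) t) =
      \<one>\<^bsub>gr K n\<^esub> \<otimes>\<^bsub>gr K n\<^esub> v n (extend (tgt P n) s + extend (src P n) t)"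
      using A.right_cancel[OF A.v_closed[OF m(1)] c(1) A.one_closed] by simp
    also have "\<dots> \<longleftrightarrow> extend (src P n) s + extend (tgt P n) t = extend (tgt P n) s + extend (src P n) t"
      unfolding 2 using m A.v_eq_iff[OF m(2,1)] by (simp only: A.l_one A.v_closed)
    finally show ?thesis by (simp add: y_def s_def t_def)
  qed
  have "bd K n \<circ> bd K (Suc n) \<in> hom (gr K (Suc (Suc n))) (gr K n)"
    using hom_compose[OF bd_hom bd_hom] by (simp add: comp_def)
  moreover have "(\<lambda>_. \<one>\<^bsub>gr K n\<^esub>) \<in> hom (gr K (Suc (Suc n))) (gr K n)"
    by (auto simp: hom_def)
  ultimately have "(\<forall>y \<in> carrier (gr K (Suc (Suc n))). bd K n (bd K (Suc n) y) = \<one>\<^bsub>gr K n\<^esub>) \<longleftrightarrow>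
      (\<forall>x \<in> cells P (Suc (Suc n)). bd K n (bd K (Suc n) (v (Suc (Suc n)) {#x#})) = \<one>\<^bsub>gr K n\<^esub>)"
    using A.hom_eqI[OF A.is_group[of n], of "bd K n \<circ> bd K (Suc n)" "Suc (Suc n)" "\<lambda>_. \<one>\<^bsub>gr K n\<^esub>"]
    by auto
  with * show ?thesis by simp
qed

text \<open>In \<open>1[0]\<close> sources and targets are empty, so moving means that both ends
  agree. In positive degrees \<open>p\<close> takes only the value \<open>{#}\<close>, so the
  condition is about cells of dimension one, where it says that source and target have the same
  augmentation.\<close>

lemma augmentation_boundary_iff:
  "(\<forall>y \<in> carrier (gr K 1). aug K (bd K 0 y) = 0) \<longleftrightarrow> p \<in> parity_hom P (point_complex pt)"
proof -
  have *: "aug K (bd K 0 (v 1 {#x#})) = 0 \<longleftrightarrow> extend (p 0) (tgt P 0 x) = extend (p 0) (src P 0 x)"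
    if x: "x \<in> cells P 1" for x
  proof -
    have st: "src P 0 x \<in> finite_multisets (cells P 0)" "tgt P 0 x \<in> finite_multisets (cells P 0)"
      using parity_structureD[OF parity, of x 0] x by auto
    have "bd K 0 (v 1 {#x#}) \<in> carrier (gr K 0)"
      using x hom_in_carrier[OF bd_hom[of 0], of "v 1 {#x#}"] by simp
    then have "aug K (bd K 0 (v 1 {#x#})) + aug K (v 0 (src P 0 x)) = aug K (v 0 (tgt P 0 x))"
      using hom_mult[OF aug_hom, of "bd K 0 (v 1 {#x#})" "v 0 (src P 0 x)"] bd_v[of x 0] x st
      by simp
    then show ?thesis
      using st finite_multisets_singleton_eq_iff[OF extend_p_0[OF st(2)] extend_p_0[OF st(1)]]
      by (auto simp: aug_v_mset)
  qed
  have "aug K \<circ> bd K 0 \<in> hom (gr K 1) integer_group"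
    using hom_compose[OF bd_hom aug_hom] by (simp add: comp_def)
  moreover have "(\<lambda>_. 0) \<in> hom (gr K 1) integer_group"
    by (auto simp: hom_def)
  ultimately have "(\<forall>y \<in> carrier (gr K 1). aug K (bd K 0 y) = 0) \<longleftrightarrow>
      (\<forall>x \<in> cells P 1. aug K (bd K 0 (v 1 {#x#})) = 0)"
    using A.hom_eqI[OF group_integer_group, of "aug K \<circ> bd K 0" 1 "\<lambda>_. 0"] by auto
  also have "\<dots> \<longleftrightarrow> (\<forall>x \<in> cells P 1. extend (p 0) (tgt P 0 x) = extend (p 0) (src P 0 x))"
    using * by simp
  also have "\<dots> \<longleftrightarrow> (\<forall>n. \<forall>x \<in> cells P (Suc n). extend (p n) (tgt P n x) = extend (p n) (src P n x))"
    (is "?l \<longleftrightarrow> ?r")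
  proof
    assume l: ?l
    show ?r
    proof (intro allI ballI)
      fix n x assume "x \<in> cells P (Suc n)"
      then show "extend (p n) (tgt P n x) = extend (p n) (src P n x)"
        using l extend_p_Suc parity_structureD[OF parity, of x n] by (cases n) auto
    qed
  qed simp
  also have "\<dots> \<longleftrightarrow> p \<in> parity_hom P (point_complex pt)"
    using p_fun by (auto simp: parity_hom_def moves_iff point_complex_def)
  finally show ?thesis .
qed

text \<open>The difference of \<open>b\<close> and \<open>a\<close> is a value of \<open>v\<close>,
  and its augmentation is a count, hence nonnegative.\<close>

lemma aug_mono:
  assumes "a \<in> carrier (gr K 0)" "b \<in> carrier (gr K 0)" "a \<preceq>\<^bsub>gr K 0\<^esub> b"
  shows "aug K a \<le> aug K b"
proof -
  obtain S where "S \<in> finite_multisets (cells P 0)" "b = a \<otimes>\<^bsub>gr K 0\<^esub> v 0 S"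
    using A.le_iff assms by blast
  then show ?thesis
    using hom_mult[OF aug_hom assms(1), of "v 0 S"] by (simp add: aug_v_mset)
qed

text \<open>The group, homomorphism and monotonicity axioms hold in every presentation. What remains
  are the two boundary equations, which the lemmas above translate.\<close>

lemma is_augmented_directed_complex_iff:
  "is_augmented_directed_complex K \<longleftrightarrow>
    is_parity_complex P \<and> p \<in> parity_hom P (point_complex pt)"
proof -
  have "is_augmented_directed_complex K \<longleftrightarrow>
      (\<forall>n. \<forall>y \<in> carrier (gr K (Suc (Suc n))). bd K n (bd K (Suc n) y) = \<one>\<^bsub>gr K n\<^esub>) \<and>
      (\<forall>y \<in> carrier (gr K 1). aug K (bd K 0 y) = 0)"
    unfolding is_augmented_directed_complex_def is_directed_complex_def
    using A.preordered_abelian_group_axioms bd_hom aug_hom aug_mono by blast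
  then show ?thesis
    unfolding boundary_boundary_iff augmentation_boundary_iff is_parity_complex_iff
    using parity by blast
qed

lemma is_free_complex: "is_free_complex K"
  unfolding is_free_complex_def complex_basis_def by (intro exI allI) (rule A.basis)

end

section \<open>Morphisms in terms of presentations\<close>

locale presentation_pair = K: presentation pt K P p v + L: presentation pt L Q q w
  for pt :: 'u and K P p v L Q q w
begin

text \<open>Agreement is required on generators only; for homomorphisms it spreads to all multisets
  by \<open>related_mset\<close>.\<close>

definition related :: "(nat \<Rightarrow> 'u \<Rightarrow> 'u) \<Rightarrow> (nat \<Rightarrow> 'u \<Rightarrow> 'u multiset) \<Rightarrow> bool"
  where "related f g \<longleftrightarrow> (\<forall>n. \<forall>x \<in> cells P n. f n (v n {#x#}) = w n (g n x))"

lemma related_mset: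
  assumes f: "f n \<in> hom (gr K n) (gr L n)"
    and g: "\<And>x. x \<in> cells P n \<Longrightarrow> g n x \<in> finite_multisets (cells Q n)"
    and fg: "related f g" and S: "S \<in> finite_multisets (cells P n)"
  shows "f n (v n S) = w n (extend (g n) S)"
  using S
proof (induction rule: finite_multisets_induct)
  case empty
  show ?case
    using hom_one[OF f K.A.is_group L.A.is_group] by (simp add: K.A.v_empty L.A.v_empty)
next
  case (add x S)
  then have "extend (g n) S \<in> finite_multisets (cells Q n)"
    by (intro extend_in_finite_multisets g)
  then show ?case
    using add fg g hom_mult[OF f, of "v n {#x#}" "v n S"]
    by (simp add: K.A.v_add_mset[OF add(1,2)] related_def L.A.v_union)
qed

text \<open>Monotonicity is automatic because \<open>f\<close> sends values of \<open>v\<close> to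
  values of \<open>w\<close>. The chain map condition, tested on generators, becomes
  \<open>moves\<close>, and preservation of the augmentation becomes the commuting triangle over
  \<open>1[0]\<close>.\<close>

lemma related_hom_iff:
  assumes f: "\<And>n. f n \<in> hom (gr K n) (gr L n)" "\<And>n. f n \<in> extensional (carrier (gr K n))"
    and g: "\<And>n. g n \<in> cells P n \<rightarrow>\<^sub>E finite_multisets (cells Q n)"
    and fg: "related f g"
  shows "f \<in> augmented_hom K L \<longleftrightarrow>
    g \<in> parity_hom P Q \<and> (\<lambda>n. \<lambda>x\<in>cells P n. extend (q n) (g n x)) = p"
proof -
  have gM: "g n x \<in> finite_multisets (cells Q n)" if "x \<in> cells P n" for n x
    using PiE_mem[OF g that] .
  have extend_g: "extend (g n) S \<in> finite_multisets (cells Q n)"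
    if "S \<in> finite_multisets (cells P n)" for n S
    using that by (rule extend_in_finite_multisets) (rule gM)
  note fv = related_mset[OF f(1) gM fg]
  have mono: "f n a \<preceq>\<^bsub>gr L n\<^esub> f n b"
    if ab: "a \<in> carrier (gr K n)" "b \<in> carrier (gr K n)" "a \<preceq>\<^bsub>gr K n\<^esub> b" for n a b
  proof -
    obtain S where S: "S \<in> finite_multisets (cells P n)" "b = a \<otimes>\<^bsub>gr K n\<^esub> v n S"
      using K.A.le_iff ab by blast
    then have "f n b = f n a \<otimes>\<^bsub>gr L n\<^esub> w n (extend (g n) S)"
      using ab hom_mult[OF f(1), of a n "v n S"] by (simp add: fv)
    then show ?thesis
      using L.A.le_iff[of "f n a" n "f n b"] hom_in_carrier[OF f(1)] ab(1,2) extend_g[OF S(1)] by blast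
  qed
  have bd: "(\<forall>a \<in> carrier (gr K (Suc n)). f n (bd K n a) = bd L n (f (Suc n) a)) \<longleftrightarrow>
      (\<forall>x \<in> cells P (Suc n).
         moves Q n (g (Suc n) x) (extend (g n) (src P n x)) (extend (g n) (tgt P n x)))" for n
  proof -
    have "f n (bd K n (v (Suc n) {#x#})) = bd L n (f (Suc n) (v (Suc n) {#x#})) \<longleftrightarrow>
        moves Q n (g (Suc n) x) (extend (g n) (src P n x)) (extend (g n) (tgt P n x))"
      if x: "x \<in> cells P (Suc n)" for x
    proof -
      let ?y = "f n (bd K n (v (Suc n) {#x#}))" and ?z = "bd L n (w (Suc n) (g (Suc n) x))"
      let ?s = "extend (g n) (src P n x)" and ?t = "extend (g n) (tgt P n x)"
      let ?s' = "extend (src Q n) (g (Suc n) x)" and ?t' = "extend (tgt Q n) (g (Suc n) x)"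
      note st = parity_structureD(1,2)[OF K.parity x]
      have M: "?s \<in> finite_multisets (cells Q n)" "?t \<in> finite_multisets (cells Q n)"
        "?s' \<in> finite_multisets (cells Q n)" "?t' \<in> finite_multisets (cells Q n)"
        using st extend_g L.extend_src[OF gM[OF x]] L.extend_tgt[OF gM[OF x]] by auto
      have y: "?y \<in> carrier (gr L n)"
        using x by (auto intro!: hom_in_carrier[OF f(1)] hom_in_carrier[OF K.bd_hom])
      have z: "?z \<in> carrier (gr L n)"
        using gM[OF x] by (auto intro!: hom_in_carrier[OF L.bd_hom])
      have "f n (bd K n (v (Suc n) {#x#}) \<otimes>\<^bsub>gr K n\<^esub> v n (src P n x)) = f n (v n (tgt P n x))"
        using K.bd_v[OF x] by simp
      then have "?y \<otimes>\<^bsub>gr L n\<^esub> w n ?s = w n ?t"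
        using hom_mult[OF f(1), of "bd K n (v (Suc n) {#x#})" n "v n (src P n x)"] st x
        by (simp add: fv hom_in_carrier[OF K.bd_hom])
      \<comment> \<open>Shifting by the same multiset \<open>?s + ?s'\<close> turns both
        \<open>?y\<close> and \<open>?z\<close> into values of \<open>w\<close>, where injectivity
        decides whether they are equal.\<close>
      then have 1: "?y \<otimes>\<^bsub>gr L n\<^esub> w n (?s + ?s') = w n (?t + ?s')"
        using M y by (simp add: L.A.v_union flip: L.A.m_assoc)
      have "?z \<otimes>\<^bsub>gr L n\<^esub> w n ?s' = w n ?t'"
        using L.bd_v_mset[OF gM[OF x]] .
      then have "(?z \<otimes>\<^bsub>gr L n\<^esub> w n ?s') \<otimes>\<^bsub>gr L n\<^esub> w n ?s = w n (?t' + ?s)"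
        using M by (simp add: L.A.v_union)
      then have 2: "?z \<otimes>\<^bsub>gr L n\<^esub> w n (?s + ?s') = w n (?t' + ?s)"
        using M z by (simp add: L.A.v_union L.A.m_ac)
      have "?y = ?z \<longleftrightarrow> w n (?t + ?s') = w n (?t' + ?s)"
        using L.A.right_cancel[OF L.A.v_closed y z, of "?s + ?s'"] M unfolding 1 2 by simp
      also have "\<dots> \<longleftrightarrow> ?s' + ?t = ?t' + ?s"
        using M by (simp add: L.A.v_eq_iff add.commute)
      finally show ?thesis
        using fg x by (simp add: moves_iff related_def)
    qed
    moreover have "f n \<circ> bd K n \<in> hom (gr K (Suc n)) (gr L n)"
      "bd L n \<circ> f (Suc n) \<in> hom (gr K (Suc n)) (gr L n)"
      using hom_compose[OF K.bd_hom f(1)] hom_compose[OF f(1) L.bd_hom] by (simp_all add: comp_def)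
    ultimately show ?thesis
      using K.A.hom_eqI[OF L.A.is_group, of "f n \<circ> bd K n" "Suc n" n "bd L n \<circ> f (Suc n)"] by auto
  qed
  have aug: "(\<forall>a \<in> carrier (gr K 0). aug L (f 0 a) = aug K a) \<longleftrightarrow>
      (\<lambda>n. \<lambda>x\<in>cells P n. extend (q n) (g n x)) = p"
  proof -
    have "aug L (f 0 (v 0 {#x#})) = aug K (v 0 {#x#}) \<longleftrightarrow> extend (q 0) (g 0 x) = p 0 x"
      if x: "x \<in> cells P 0" for x
      using x fg gM[OF x] finite_multisets_singleton_eq_iff[OF L.extend_p_0[OF gM[OF x]] K.p_0[OF x]]
      by (simp add: related_def L.aug_v_mset K.aug_v)
    moreover have "aug L \<circ> f 0 \<in> hom (gr K 0) integer_group"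
      using hom_compose[OF f(1) L.aug_hom] by (simp add: comp_def)
    ultimately have "(\<forall>a \<in> carrier (gr K 0). aug L (f 0 a) = aug K a) \<longleftrightarrow>
        (\<forall>x \<in> cells P 0. extend (q 0) (g 0 x) = p 0 x)"
      using K.A.hom_eqI[OF group_integer_group _ K.aug_hom, of "aug L \<circ> f 0"] by auto
    \<comment> \<open>In positive degrees both sides are \<open>{#}\<close>.\<close>
    also have "\<dots> \<longleftrightarrow> (\<forall>n. \<forall>x \<in> cells P n. extend (q n) (g n x) = p n x)"
      (is "?l \<longleftrightarrow> ?r")
    proof
      assume l: ?l
      show ?r
      proof (intro allI ballI)
        fix n x assume "x \<in> cells P n"
        then show "extend (q n) (g n x) = p n x"
          using l by (cases n) (auto simp: K.p_Suc L.extend_p_Suc gM)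
      qed
    qed simp
    also have "\<dots> \<longleftrightarrow> (\<lambda>n. \<lambda>x\<in>cells P n. extend (q n) (g n x)) = p"
      using PiE_arb[OF K.p_fun] by (auto simp: fun_eq_iff restrict_def)
    finally show ?thesis .
  qed
  show ?thesis
    unfolding augmented_hom_def directed_hom_def parity_hom_def mem_Collect_eq bd aug
    using f g mono by blast
qed

text \<open>Monotonicity places the image of a generator in the positive cone, hence among the
  values of \<open>w\<close>; the unique multiset with that value defines \<open>g\<close>.\<close>

lemma ex1_related_parity_hom:
  assumes "f \<in> augmented_hom K L"
  shows "\<exists>!g. (g \<in> parity_hom P Q \<and> (\<lambda>n. \<lambda>x\<in>cells P n. extend (q n) (g n x)) = p) \<and> related f g"
proof (rule ex_ex1I)
  have f: "f n \<in> hom (gr K n) (gr L n)" "f n \<in> extensional (carrier (gr K n))" for n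
    using assms by (auto simp: augmented_hom_def directed_hom_def)
  have pos: "\<exists>S \<in> finite_multisets (cells Q n). f n (v n {#x#}) = w n S" if "x \<in> cells P n" for n x
  proof (rule L.A.v_surj)
    have "\<one>\<^bsub>gr K n\<^esub> \<preceq>\<^bsub>gr K n\<^esub> v n {#x#}"
      using K.A.v_positive[of "{#x#}" n] that by (simp add: positive_cone_def)
    then have "f n \<one>\<^bsub>gr K n\<^esub> \<preceq>\<^bsub>gr L n\<^esub> f n (v n {#x#})"
      using assms that by (auto simp: augmented_hom_def directed_hom_def)
    then show "f n (v n {#x#}) \<in> positive_cone (gr L n)"
      using hom_one[OF f(1) K.A.is_group L.A.is_group] that hom_in_carrier[OF f(1)]
      by (simp add: positive_cone_def)
  qed
  define g where "g n = (\<lambda>x\<in>cells P n. SOME S. S \<in> finite_multisets (cells Q n) \<and> f n (v n {#x#}) = w n S)" for n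
  have g: "g n x \<in> finite_multisets (cells Q n) \<and> f n (v n {#x#}) = w n (g n x)"
    if "x \<in> cells P n" for n x
    using someI_ex[OF pos[OF that, unfolded Bex_def]] that by (simp add: g_def)
  have gE: "g n \<in> cells P n \<rightarrow>\<^sub>E finite_multisets (cells Q n)" for n
    using g by (auto simp: g_def)
  have "related f g" using g by (simp add: related_def)
  then show "\<exists>g. (g \<in> parity_hom P Q \<and> (\<lambda>n. \<lambda>x\<in>cells P n. extend (q n) (g n x)) = p) \<and> related f g"
    using related_hom_iff[OF f gE] assms by blast
next
  fix g h
  assume "(g \<in> parity_hom P Q \<and> (\<lambda>n. \<lambda>x\<in>cells P n. extend (q n) (g n x)) = p) \<and> related f g"
    and "(h \<in> parity_hom P Q \<and> (\<lambda>n. \<lambda>x\<in>cells P n. extend (q n) (h n x)) = p) \<and> related f h"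
  then have g: "g \<in> parity_hom P Q" "related f g" and h: "h \<in> parity_hom P Q" "related f h"
    by blast+
  show "g = h"
  proof (intro ext)
    fix n x
    show "g n x = h n x"
    proof (cases "x \<in> cells P n")
      case True
      then have "w n (g n x) = w n (h n x)" using g(2) h(2) by (simp add: related_def)
      then show ?thesis
        using L.A.v_eq_iff[OF parity_hom_in_finite_multisets[OF g(1) True]
            parity_hom_in_finite_multisets[OF h(1) True]] by blast
    next
      case False
      then show ?thesis using parity_hom_extensional[OF g(1)] parity_hom_extensional[OF h(1)] by simp
    qed
  qed
qed

text \<open>The map sending \<open>S\<close> to \<open>w n (extend (g n) S)\<close> is additive, so
  \<open>hom_extension\<close> provides \<open>f\<close>. Values on generators and extensionality
  make it unique.\<close>

lemma ex1_related_augmented_hom: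
  assumes "g \<in> parity_hom P Q" "(\<lambda>n. \<lambda>x\<in>cells P n. extend (q n) (g n x)) = p"
  shows "\<exists>!f. f \<in> augmented_hom K L \<and> related f g"
proof (rule ex_ex1I)
  have g: "g n \<in> cells P n \<rightarrow>\<^sub>E finite_multisets (cells Q n)" for n
    using assms(1) by (simp add: parity_hom_def)
  have gM: "extend (g n) S \<in> finite_multisets (cells Q n)" if "S \<in> finite_multisets (cells P n)" for n S
    using that by (rule extend_in_finite_multisets) (rule PiE_mem[OF g])
  have "\<exists>f. f \<in> hom (gr K n) (gr L n) \<and> f \<in> extensional (carrier (gr K n)) \<and>
      (\<forall>S \<in> finite_multisets (cells P n). f (v n S) = w n (extend (g n) S))" for n
    by (rule K.A.hom_extension[OF L.A.comm_group_axioms, of n "\<lambda>S. w n (extend (g n) S)" n])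
      (auto simp: gM L.A.v_union)
  then obtain f where f: "\<And>n. f n \<in> hom (gr K n) (gr L n)" "\<And>n. f n \<in> extensional (carrier (gr K n))"
      "\<And>n S. S \<in> finite_multisets (cells P n) \<Longrightarrow> f n (v n S) = w n (extend (g n) S)"
    by metis
  have "related f g" using f(3) by (simp add: related_def)
  then show "\<exists>f. f \<in> augmented_hom K L \<and> related f g"
    using related_hom_iff[OF f(1,2) g] assms by blast
next
  fix f f' assume "f \<in> augmented_hom K L \<and> related f g" "f' \<in> augmented_hom K L \<and> related f' g"
  then have f: "f n \<in> hom (gr K n) (gr L n)" "f n \<in> extensional (carrier (gr K n))"
      "f' n \<in> hom (gr K n) (gr L n)" "f' n \<in> extensional (carrier (gr K n))"
      "x \<in> cells P n \<Longrightarrow> f n (v n {#x#}) = f' n (v n {#x#})" for n x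
    by (auto simp: augmented_hom_def directed_hom_def related_def)
  show "f = f'"
  proof (rule ext)
    fix n
    show "f n = f' n"
      using f(2,4) K.A.hom_eqI[OF L.A.is_group f(1,3,5)] by (rule extensionalityI)
  qed
qed

end

section \<open>Existence of presentations\<close>

text \<open>The cells are the basis elements. The boundary of each is split into disjoint source and
  target, and its augmentation becomes a multiple of \<open>pt\<close>.\<close>

lemma ex_presentation_of_free_complex:
  fixes K :: "'u augmented_complex"
  assumes K: "is_augmented_directed_complex K" and "is_free_complex K"
  shows "\<exists>P p v. presentation pt K P p v"
proof -
  obtain B where B: "\<And>n. preordered_group_basis (gr K n) (B n)"
    using assms(2) by (auto simp: is_free_complex_def complex_basis_def)
  have A: "preordered_abelian_group (gr K n)" and bd: "bd K n \<in> hom (gr K (Suc n)) (gr K n)"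
    and aug: "aug K \<in> hom (gr K 0) integer_group"
    and aug_mono: "\<And>a b. \<lbrakk>a \<in> carrier (gr K 0); b \<in> carrier (gr K 0); a \<preceq>\<^bsub>gr K 0\<^esub> b\<rbrakk> \<Longrightarrow> aug K a \<le> aug K b"
    for n
    using K by (auto simp: is_augmented_directed_complex_def is_directed_complex_def)
  have "\<exists>v. presented_group (gr K n) (B n) v" for n
    using A B by (rule preordered_abelian_group.presented_group_if_basis)
  then obtain v where v: "\<And>n. presented_group (gr K n) (B n) (v n)" by metis
  interpret A: presented_group "gr K n" "B n" "v n" for n by (rule v)
  define bd_rep where "bd_rep n x S T \<longleftrightarrow> S \<in> finite_multisets (B n) \<and> T \<in> finite_multisets (B n) \<and>
      S \<inter># T = {#} \<and> bd K n (v (Suc n) {#x#}) \<otimes>\<^bsub>gr K n\<^esub> v n S = v n T" for n x S T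
  have "\<exists>S T. bd_rep n x S T" if "x \<in> B (Suc n)" for n x
    using A.v_generates_disjoint[OF hom_in_carrier[OF bd A.v_closed], of "{#x#}" n] that
    by (auto simp: bd_rep_def)
  then have "\<forall>n x. \<exists>S T. x \<in> B (Suc n) \<longrightarrow> bd_rep n x S T" by blast
  then obtain s t where "\<And>n x. x \<in> B (Suc n) \<Longrightarrow> bd_rep n x (s n x) (t n x)"
    unfolding choice_iff by blast
  note st = this[unfolded bd_rep_def]
  define P where "P = \<lparr>cells = B, src = s, tgt = t\<rparr>"
  \<comment> \<open>\<open>nat\<close> loses nothing: generators are positive and
    \<open>aug K\<close> is monotone, so their augmentations are nonnegative.\<close>
  define p where "p n = (\<lambda>x\<in>B n. if n = 0 then replicate_mset (nat (aug K (v 0 {#x#}))) pt else {#})" for n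
  have "presentation pt K P p v"
  proof (rule presentation.intro)
    show "presented_group (gr K n) (cells P n) (v n)" for n
      using v by (simp add: P_def)
    show "is_parity_structure P"
      using st by (simp add: is_parity_structure_def P_def)
    show "bd K n \<in> hom (gr K (Suc n)) (gr K n)" "aug K \<in> hom (gr K 0) integer_group" for n
      by (fact bd aug)+
    show "p n \<in> cells P n \<rightarrow>\<^sub>E finite_multisets (cells (point_complex pt) n)" for n
      by (auto simp: P_def p_def point_complex_def finite_multisets_def)
    fix x
    show "bd K n (v (Suc n) {#x#}) \<otimes>\<^bsub>gr K n\<^esub> v n (src P n x) = v n (tgt P n x)"
      if "x \<in> cells P (Suc n)" for n
      using st that by (simp add: P_def)
    assume x: "x \<in> cells P 0"
    then have "v 0 {#x#} \<in> positive_cone (gr K 0)"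
      by (intro A.v_positive) (simp add: P_def)
    then have "aug K \<one>\<^bsub>gr K 0\<^esub> \<le> aug K (v 0 {#x#})"
      by (intro aug_mono) (auto simp: positive_cone_def)
    then have "0 \<le> aug K (v 0 {#x#})"
      using hom_one[OF aug A.is_group group_integer_group] by simp
    then show "aug K (v 0 {#x#}) = int (count (p 0 x) pt)"
      using x by (simp add: p_def P_def)
  qed
  then show ?thesis by blast
qed

text \<open>\<open>K\<close> consists of copies of the free abelian groups on the cells, ordered so
  that the cone is the multisets, with boundary target minus source. The augmentation is the
  multiplicity of \<open>pt\<close> under the linear extension of \<open>p 0\<close>.\<close>

lemma ex_presentation_of_parity_complex:
  fixes P :: "'u parity_structure"
  assumes inf: "infinite (UNIV :: 'u set)" and P: "is_parity_structure P"
    and p: "\<And>n. p n \<in> cells P n \<rightarrow>\<^sub>E finite_multisets (cells (point_complex pt) n)"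
  shows "\<exists>K v. presentation pt K P p v"
proof -
  \<comment> \<open>An infinite type is equipollent to the free abelian group on it. The resulting
    injection \<open>enc\<close> carries all operations into the universe.\<close>
  have "(UNIV :: ('u \<Rightarrow>\<^sub>0 int) set) \<approx> (UNIV :: 'u set)"
    using eqpoll_free_Abelian_group_infinite[OF inf] by (simp add: free_Abelian_group_def)
  then obtain enc :: "('u \<Rightarrow>\<^sub>0 int) \<Rightarrow> 'u" where enc: "inj enc"
    by (auto simp: eqpoll_def bij_betw_def)
  define dec where "dec = the_inv enc"
  have dec [simp]: "dec (enc c) = c" for c
    using enc by (simp add: dec_def the_inv_f_f)
  have enc_eq [simp]: "enc c = enc d \<longleftrightarrow> c = d" for c d
    using enc by (auto dest: injD)
  define Z where "Z n = {c :: 'u \<Rightarrow>\<^sub>0 int. Poly_Mapping.keys c \<subseteq> cells P n}" for n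
  have Z [simp]: "0 \<in> Z n" "\<lbrakk>c \<in> Z n; d \<in> Z n\<rbrakk> \<Longrightarrow> c + d \<in> Z n" "c \<in> Z n \<Longrightarrow> - c \<in> Z n"
    "\<lbrakk>c \<in> Z n; d \<in> Z n\<rbrakk> \<Longrightarrow> c - d \<in> Z n" "frag_of_mset S \<in> Z n \<longleftrightarrow> S \<in> finite_multisets (cells P n)" for n c d S
    using keys_diff[of c d] by (auto simp: Z_def finite_multisets_def)
  define A where "A n =
    \<lparr>carrier = enc ` Z n, monoid.mult = (\<lambda>a b. enc (dec a + dec b)), one = enc 0,
     pre_le = (\<lambda>a b. \<exists>S \<in> finite_multisets (cells P n). dec b = dec a + frag_of_mset S)\<rparr>" for n
  define \<delta> where "\<delta> n = frag_extend (\<lambda>x. frag_of_mset (tgt P n x) - frag_of_mset (src P n x))" for n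
  define \<epsilon> where "\<epsilon> = (\<lambda>c. Poly_Mapping.lookup (frag_extend (\<lambda>x. frag_of_mset (p 0 x)) c) pt)"
  define K where "K = \<lparr>gr = A, bd = (\<lambda>n a. enc (\<delta> n (dec a))), aug = (\<lambda>a. \<epsilon> (dec a))\<rparr>"
  define v where "v n S = enc (frag_of_mset S)" for n :: nat and S
  have \<delta>_Z: "\<delta> n c \<in> Z n" if "c \<in> Z (Suc n)" for n c
    using that unfolding Z_def[of "Suc n"] mem_Collect_eq
  proof (induction rule: frag_induction)
    case (one x)
    then show ?case using parity_structureD[OF P one] by (simp add: \<delta>_def)
  qed (auto simp: \<delta>_def frag_extend_diff)
  have comm: "comm_group (A n)" for n
  proof (rule comm_groupI)
    fix a assume "a \<in> carrier (A n)"
    then show "\<exists>y\<in>carrier (A n). y \<otimes>\<^bsub>A n\<^esub> a = \<one>\<^bsub>A n\<^esub>"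
      by (intro bexI[of _ "enc (- dec a)"]) (auto simp: A_def)
  qed (auto simp: A_def ac_simps)
  have pog: "preordered_abelian_group (A n)" for n
    unfolding preordered_abelian_group_def preordered_abelian_group_axioms_def
  proof (intro conjI comm allI impI)
    fix a b c
    show "a \<preceq>\<^bsub>A n\<^esub> a"
      by (auto simp: A_def intro!: bexI[of _ "{#}"])
    assume "a \<preceq>\<^bsub>A n\<^esub> b"
    then obtain S where S: "S \<in> finite_multisets (cells P n)" "dec b = dec a + frag_of_mset S"
      by (auto simp: A_def)
    show "a \<otimes>\<^bsub>A n\<^esub> c \<preceq>\<^bsub>A n\<^esub> b \<otimes>\<^bsub>A n\<^esub> c"
      using S by (auto simp: A_def ac_simps intro!: bexI[of _ S])
    assume "b \<preceq>\<^bsub>A n\<^esub> c"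
    then obtain T where "T \<in> finite_multisets (cells P n)" "dec c = dec b + frag_of_mset T"
      by (auto simp: A_def)
    with S show "a \<preceq>\<^bsub>A n\<^esub> c"
      by (auto simp: A_def ac_simps intro!: bexI[of _ "S + T"])
  qed
  have "presentation pt K P p v"
  proof (rule presentation.intro)
    show "presented_group (gr K n) (cells P n) (v n)" for n
      unfolding presented_group_def presented_group_axioms_def
    proof (intro conjI allI impI)
      show "preordered_abelian_group (gr K n)" using pog by (simp add: K_def)
      show "v n {#} = \<one>\<^bsub>gr K n\<^esub>" by (simp add: v_def K_def A_def)
      show "v n (S + T) = v n S \<otimes>\<^bsub>gr K n\<^esub> v n T" for S T
        by (simp add: v_def K_def A_def)
      have "v n ` finite_multisets (cells P n) = positive_cone (gr K n)"
        by (auto simp: v_def K_def A_def positive_cone_def)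
      then show "bij_betw (v n) (finite_multisets (cells P n)) (positive_cone (gr K n))"
        by (simp add: bij_betw_def inj_on_def v_def)
      fix a assume "a \<in> carrier (gr K n)"
      then obtain c where c: "a = enc c" "Poly_Mapping.keys c \<subseteq> cells P n"
        by (auto simp: K_def A_def Z_def)
      then show "\<exists>S\<in>finite_multisets (cells P n). \<exists>T\<in>finite_multisets (cells P n).
          a \<otimes>\<^bsub>gr K n\<^esub> v n T = v n S"
        using frag_as_difference[OF c(2)] by (simp add: K_def A_def v_def)
    qed
    show "bd K n \<in> hom (gr K (Suc n)) (gr K n)" for n
      using \<delta>_Z by (auto simp: hom_def K_def A_def) (auto simp: \<delta>_def frag_extend_add)
    show "aug K \<in> hom (gr K 0) integer_group"
      by (auto simp: hom_def K_def A_def \<epsilon>_def frag_extend_add lookup_add)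
    fix x
    show "bd K n (v (Suc n) {#x#}) \<otimes>\<^bsub>gr K n\<^esub> v n (src P n x) = v n (tgt P n x)" for n
      by (simp add: K_def A_def v_def \<delta>_def)
    show "aug K (v 0 {#x#}) = int (count (p 0 x) pt)"
      by (simp add: K_def v_def \<epsilon>_def)
  qed (use P p in auto)
  then show ?thesis by blast
qed

theorem corollary3p12:
  fixes pt :: 'u
  assumes "infinite (UNIV :: 'u set)"
  shows "equivalent_categories
    (FreeADC :: ('u augmented_complex, nat \<Rightarrow> 'u \<Rightarrow> 'u) cat)
    (slice (APC :: ('u parity_structure, nat \<Rightarrow> 'u \<Rightarrow> 'u multiset) cat) (point_complex pt))"
proof (rule equivalent_categories_if_correspondence)
  \<comment> \<open>An element of \<open>W\<close> is an augmented directed complex with a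
    presentation of it. Both projections are onto the objects by the existence lemmas, and arrows
    correspond when they agree on generators.\<close>
  define W where "W = {(K, P, p, v). presentation pt K P p v \<and> is_augmented_directed_complex K}"
  let ?l = "\<lambda>(K, P, p, v). K" and ?r = "\<lambda>(K, P, p, v). (P, p)"
  let ?R = "\<lambda>(K, P, p, v) (L, Q, q, w). presentation_pair.related P v w"
  show "category (FreeADC :: ('u augmented_complex, nat \<Rightarrow> 'u \<Rightarrow> 'u) cat)"
    unfolding FreeADC_def by (intro category_full_subcategory category_ADC)
  show "category (slice APC (point_complex pt))"
    by (intro category_slice category_APC point_complex_in_APC)
  have FObj: "Obj FreeADC = {K :: 'u augmented_complex. is_augmented_directed_complex K \<and> is_free_complex K}"
    and FHom: "Hom FreeADC = (augmented_hom :: 'u augmented_complex \<Rightarrow> _)"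
    by (simp_all add: FreeADC_def full_subcategory_def ADC_def)
  have SObj: "Obj (slice APC (point_complex pt)) =
      {(P, p). is_parity_complex P \<and> p \<in> parity_hom P (point_complex pt)}"
    by (simp add: slice_def APC_def)
  have SHom: "Hom (slice APC (point_complex pt)) (P, p) (Q, q) =
      {g \<in> parity_hom P Q. (\<lambda>n. \<lambda>x\<in>cells P n. extend (q n) (g n x)) = p}" for P p Q q
    by (simp add: slice_def APC_def)
  show "?l ` W = Obj FreeADC"
  proof (intro equalityI subsetI)
    fix K assume "K \<in> ?l ` W"
    then show "K \<in> Obj FreeADC"
      by (auto simp: W_def FObj dest: presentation.is_free_complex)
  next
    fix K :: "'u augmented_complex" assume "K \<in> Obj FreeADC"
    then show "K \<in> ?l ` W"
      using ex_presentation_of_free_complex[of K pt] by (force simp: W_def FObj)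
  qed
  show "?r ` W = Obj (slice APC (point_complex pt))"
  proof (intro equalityI subsetI)
    fix X assume "X \<in> ?r ` W"
    then show "X \<in> Obj (slice APC (point_complex pt))"
      by (auto simp: W_def SObj presentation.is_augmented_directed_complex_iff)
  next
    fix X :: "'u parity_structure \<times> (nat \<Rightarrow> 'u \<Rightarrow> 'u multiset)"
    assume "X \<in> Obj (slice APC (point_complex pt))"
    then obtain P p where X: "X = (P, p)" "is_parity_complex P" "p \<in> parity_hom P (point_complex pt)"
      by (auto simp: SObj)
    then obtain K v where "presentation pt K P p v"
      using ex_presentation_of_parity_complex[OF assms, of P p pt]
      by (auto simp: is_parity_complex_def parity_hom_def)
    with X have "(K, P, p, v) \<in> W"
      by (simp add: W_def presentation.is_augmented_directed_complex_iff)
    then show "X \<in> ?r ` W" using X(1) by force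
  qed
  have pair: "presentation_pair pt K P p v L Q q w"
    if "(K, P, p, v) \<in> W" "(L, Q, q, w) \<in> W" for K P p v L Q q w
    using that by (simp add: W_def presentation_pair_def)
  {
    fix V V' f
    assume V: "V \<in> W" "V' \<in> W" and f: "f \<in> Hom FreeADC (?l V) (?l V')"
    obtain K P p v L Q q w where [simp]: "V = (K, P, p, v)" "V' = (L, Q, q, w)"
      by (metis prod_cases4)
    interpret presentation_pair pt K P p v L Q q w using V by (simp add: pair)
    show "\<exists>!g. g \<in> Hom (slice APC (point_complex pt)) (?r V) (?r V') \<and> ?R V V' f g"
      using f ex1_related_parity_hom by (simp add: FHom SHom)
  }
  {
    fix V V' g
    assume V: "V \<in> W" "V' \<in> W" and g: "g \<in> Hom (slice APC (point_complex pt)) (?r V) (?r V')"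
    obtain K P p v L Q q w where [simp]: "V = (K, P, p, v)" "V' = (L, Q, q, w)"
      by (metis prod_cases4)
    interpret presentation_pair pt K P p v L Q q w using V by (simp add: pair)
    show "\<exists>!f. f \<in> Hom FreeADC (?l V) (?l V') \<and> ?R V V' f g"
      using g ex1_related_augmented_hom by (simp add: FHom SHom)
  }
  {
    fix V assume V: "V \<in> W"
    obtain K P p v where [simp]: "V = (K, P, p, v)"
      by (metis prod_cases4)
    interpret presentation_pair pt K P p v K P p v using V by (simp add: pair)
    show "?R V V (Id FreeADC (?l V)) (Id (slice APC (point_complex pt)) (?r V))"
      by (simp add: related_def FreeADC_def full_subcategory_def ADC_def slice_def APC_def)
  }
  {
    fix V V' V'' f g f' g'
    assume V: "V \<in> W" "V' \<in> W" "V'' \<in> W"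
      and f: "f \<in> Hom FreeADC (?l V) (?l V')" "f' \<in> Hom (slice APC (point_complex pt)) (?r V) (?r V')"
        "?R V V' f f'"
      and g: "g \<in> Hom FreeADC (?l V') (?l V'')" "g' \<in> Hom (slice APC (point_complex pt)) (?r V') (?r V'')"
        "?R V' V'' g g'"
    obtain K P p v L Q q w M S s u where
      [simp]: "V = (K, P, p, v)" "V' = (L, Q, q, w)" "V'' = (M, S, s, u)"
      by (metis prod_cases4)
    interpret KL: presentation_pair pt K P p v L Q q w using V by (simp add: pair)
    interpret LM: presentation_pair pt L Q q w M S s u using V by (simp add: pair)
    interpret KM: presentation_pair pt K P p v M S s u using V by (simp add: pair)
    have "g n \<in> hom (gr L n) (gr M n)" for n
      using g(1) by (auto simp: FHom augmented_hom_def directed_hom_def)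
    moreover have "f' \<in> parity_hom P Q" "g' \<in> parity_hom Q S"
      using f(2) g(2) by (auto simp: SHom)
    \<comment> \<open>Relatedness of \<open>g\<close> and \<open>g'\<close> is known on generators,
      but \<open>f' n x\<close> is a multiset, so it is first extended by
      \<open>related_mset\<close>.\<close>
    ultimately have "g n (w n (f' n x)) = u n (extend (g' n) (f' n x))" if "x \<in> cells P n" for n x
      using LM.related_mset[of g n g' "f' n x"] g(3) that by (simp add: parity_hom_in_finite_multisets)
    then show "?R V V'' (Comp FreeADC (?l V) (?l V') (?l V'') g f)
        (Comp (slice APC (point_complex pt)) (?r V) (?r V') (?r V'') g' f')"
      using f(3)
      by (simp add: KL.related_def KM.related_def FreeADC_def full_subcategory_def ADC_def slice_def
          APC_def compose_def)
  }
qed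

end
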